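(* Let $N$ and $k$ be integers with $1<k<N$, let $\gamma\in\mathbb R$, let $A,B,Q$ be real numbers, and let either $$N=2,\qquad Q\ge2,\qquad B=A-1+\frac{Q-2}{2Q}\,(2+\gamma(k-1)),$$ or else $$N\ge3,\qquad 2\le Q\le\frac{2N}{N-2},\qquad B=A-1+\frac{Q-2}{2Q}\,(N+\gamma(k-1)).$$ Suppose that $BQ+2A\ne0$. Then: (i) There exists a positive constant $C=C(A,Q,N,k,\gamma)$ such that for every $f\in C_0^\infty(\mathbb R^N_+)$ $$\left(\int_{\mathbb R^N_+}x_N^{BQ}|f(x)|^Q\,dx\right)^{\frac2Q}\le C\int_{\mathbb R^N_+}x_N^{2A}\left(|\nabla_{x',x_N}f|^2+x_N^{2\gamma}|\nabla_yf|^2\right)dx.$$ (ii) If moreover $BQ+2A>0$, the same inequality still holds (with integrals over $\mathbb R^N_+$) for every $f\in C_0^\infty(\mathbb R^N)$.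
   Context: Points $x\in\mathbb R^N$ are written $x=(x',x_N,y)$ with $x'\in\mathbb R^{N-k}$, $x_N\in\mathbb R$ and $y\in\mathbb R^{k-1}$, and $\mathbb R^N_+$ is the half space $\{x_N>0\}$; $dx=dx'\,dx_N\,dy$. $\nabla_{x',x_N}$ is the gradient in the variables $(x',x_N)$ and $\nabla_y$ the gradient in the variables $y$. $C_0^\infty(U)$ denotes the smooth real-valued functions with compact support in the open set $U$. The right-hand side may be $+\infty$ in part (ii), in which case the inequality is trivially true. *)

theory Defs
  imports "HOL-Analysis.Analysis"
begin

text \<open>
  A point \<open>x = (x', x\<^sub>N, y)\<close> with \<open>x'\<close> in dimension \<open>N - k\<close> (\<open>'m\<close>), \<open>x\<^sub>N\<close> real and \<open>y\<close> in
  dimension \<open>k - 1\<close> (\<open>'p\<close>); the Euclidean norm and \<^const>\<open>lborel\<close> on the product type are the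
  standard norm and Lebesgue measure of the \<open>N\<close>-dimensional space.
\<close>

type_synonym ('m, 'p) point = "(real ^ 'm) \<times> real \<times> (real ^ 'p)"

fun height :: "('m::finite, 'p::finite) point \<Rightarrow> real" where
  "height (x', t, y) = t"

definition half_space :: "('m::finite, 'p::finite) point set" where
  "half_space = {x. height x > 0}"

primrec C_k :: "nat \<Rightarrow> ('a::euclidean_space \<Rightarrow> real) \<Rightarrow> bool" where
  "C_k 0 f \<longleftrightarrow> continuous_on UNIV f"
| "C_k (Suc n) f \<longleftrightarrow> f differentiable_on UNIV \<and>
     (\<forall>b\<in>Basis. C_k n (\<lambda>x. frechet_derivative f (at x) b))"

definition smooth :: "('a::euclidean_space \<Rightarrow> real) \<Rightarrow> bool" where
  "smooth f \<longleftrightarrow> (\<forall>n. C_k n f)"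

text \<open>
  Elements of \<open>C\<^sub>0\<^sup>\<infinity>(U)\<close> are identified with their extensions by zero, which are smooth on the
  whole space because the support is a compact subset of the open set \<open>U\<close>.
\<close>

definition test_functions :: "'a::euclidean_space set \<Rightarrow> ('a \<Rightarrow> real) set" where
  "test_functions U =
     {f. smooth f \<and> compact (closure {x. f x \<noteq> 0}) \<and> closure {x. f x \<noteq> 0} \<subseteq> U}"

definition grad :: "('a::euclidean_space \<Rightarrow> real) \<Rightarrow> 'a \<Rightarrow> 'a" where
  "grad f x = (THE D. GDERIV f x :> D)"

lemma grad_eqI:
  assumes "GDERIV f x :> D"
  shows "grad f x = D"
  unfolding grad_def
proof (rule the_equality)
  fix D' assume "GDERIV f x :> D'"
  with assms have "(\<lambda>h. inner h D') = (\<lambda>h. inner h D)"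
    unfolding gderiv_def by (rule has_derivative_unique[symmetric])
  then show "D' = D"
    by (metis inner_commute vector_eq_rdot)
qed (rule assms)

fun grad_x :: "(('m::finite, 'p::finite) point \<Rightarrow> real) \<Rightarrow> ('m, 'p) point \<Rightarrow> (real ^ 'm) \<times> real" where
  "grad_x f (x', t, y) = grad (\<lambda>(u, s). f (u, s, y)) (x', t)"

fun grad_y :: "(('m::finite, 'p::finite) point \<Rightarrow> real) \<Rightarrow> ('m, 'p) point \<Rightarrow> real ^ 'p" where
  "grad_y f (x', t, y) = grad (\<lambda>v. f (x', t, v)) y"

text \<open>Real powers on \<open>[0, \<infinity>]\<close>, meant for exponents \<open>p > 0\<close>.\<close>

definition enn_powr :: "ennreal \<Rightarrow> real \<Rightarrow> ennreal" where
  "enn_powr a p = (if a = \<infinity> then \<infinity> else ennreal (enn2real a powr p))"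

text \<open>
  Both integrals are taken in \<open>[0, \<infinity>]\<close>: an infinite right-hand side makes the inequality trivial,
  while a finite one forces the left-hand integral to be finite.
\<close>

definition weighted_ineq ::
  "real \<Rightarrow> real \<Rightarrow> real \<Rightarrow> real \<Rightarrow> real \<Rightarrow> (('m::finite, 'p::finite) point \<Rightarrow> real) \<Rightarrow> bool" where
  "weighted_ineq C A B Q \<gamma> f \<longleftrightarrow>
     enn_powr (\<integral>\<^sup>+x\<in>half_space. ennreal (height x powr (B * Q) * \<bar>f x\<bar> powr Q) \<partial>lborel) (2 / Q)
     \<le> ennreal C *
       (\<integral>\<^sup>+x\<in>half_space. ennreal (height x powr (2 * A) *
          ((norm (grad_x f x))\<^sup>2 + height x powr (2 * \<gamma>) * (norm (grad_y f x))\<^sup>2)) \<partial>lborel)"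

end

theory Submission
  imports Defs
begin

text \<open>
  Write \<open>t\<close> for the height, \<open>p = k - 1\<close>, \<open>D = N + \<gamma> p\<close>, and let \<open>X\<close> and \<open>W\<close> be the integrals of
  \<open>t\<^bsup>BQ\<^esup> |f|\<^bsup>Q\<^esup>\<close> and of the weighted energy density.  The quadratic inequality is reduced to an
  \<open>L\<^sup>1\<close> inequality for \<open>G = |f|\<^bsup>s\<^esup>\<close> with \<open>s = Q/2 + 1\<close>.  Put \<open>a = (BQ + 2A)/2\<close>.  By Cauchy--Schwarz,
  the integrals \<open>E\<^sub>b\<close> of \<open>t\<^sup>a |\<partial>\<^sub>b G|\<close> (for \<open>b\<close> among the directions \<open>x', x\<^sub>N\<close>) and of
  \<open>t\<^bsup>a+\<gamma>\<^esup> |\<partial>\<^sub>b G|\<close> (for \<open>b\<close> among the directions \<open>y\<close>) are all at most \<open>s (X W)\<^bsup>1/2\<^esup>\<close>.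

  Two endpoint inequalities hold for \<open>G\<close>.  The one-dimensional Hardy inequality in \<open>t\<close> bounds the
  integral of \<open>t\<^bsup>a-1\<^esup> G\<close> by \<open>E\<^sub>b / |a|\<close> with \<open>b\<close> the vertical direction; this is where
  \<open>BQ + 2A \<noteq> 0\<close> enters, and its sign decides whether \<open>G\<close> has to vanish at the boundary.  The other
  endpoint is the Gagliardo--Nirenberg argument: integrating along a line in direction \<open>b\<close>, each of
  \<open>t\<^sup>a G\<close> and \<open>t\<^bsup>a+\<gamma>\<^esup> G\<close> is at most the corresponding line integral of the derivative.  The geometric
  mean of these \<open>N\<close> bounds controls \<open>t\<^bsup>a + \<gamma> p/N\<^esup> G\<close>, and the Loomis--Whitney inequality then controls
  its norm in \<open>L\<^bsup>N/(N-1)\<^esup>\<close> by the geometric mean of the \<open>E\<^sub>b\<close>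
  (lemmas \<open>Hardy\<close> and \<open>Sobolev\<close> of the locale \<open>truncated_C1\<close>).

  The condition on \<open>B\<close> is exactly what makes \<open>t\<^bsup>BQ\<^esup> |f|\<^bsup>Q\<^esup>\<close> a geometric mean, with weights \<open>\<alpha>\<close> and
  \<open>\<beta> = 1 - \<alpha>\<close>, of the two integrands, and \<open>2 \<le> Q \<le> 2N/(N-2)\<close> is exactly \<open>0 \<le> \<beta> \<le> 1\<close>.  Hoelder's
  inequality gives \<open>X \<le> C (X W)\<^bsup>Q/(Q+2)\<^esup>\<close>, and dividing by the power of \<open>X\<close> yields the theorem
  (lemma \<open>caffarelli_kohn_nirenberg_truncated\<close>).

  The division needs \<open>X\<close> to be finite, which is not clear when \<open>f\<close> does not vanish on the boundary.
  Therefore everything is done on \<open>{t > \<delta>}\<close>, where all integrals of compactly supported functions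
  converge, with constants that do not depend on \<open>\<delta>\<close>; then \<open>\<delta> \<rightarrow> 0\<close> by monotone convergence.
\<close>

section \<open>Powers and Hoelder's inequality in the extended nonnegative reals\<close>

lemma enn_powr_ennreal: "0 \<le> a \<Longrightarrow> enn_powr (ennreal a) p = ennreal (a powr p)"
  by (simp add: enn_powr_def)

lemma enn_powr_top [simp]: "enn_powr top p = top"
  by (simp add: enn_powr_def)

lemma enn_powr_zero [simp]: "enn_powr 0 p = 0"
  by (simp add: enn_powr_def)

lemma enn_powr_one [simp]: "enn_powr a 1 = a"
  by (cases a) (auto simp: enn_powr_def)

lemma enn_powr_eq_0_iff [simp]: "enn_powr a p = 0 \<longleftrightarrow> a = 0"
  by (cases a) (auto simp: enn_powr_def)

lemma enn_powr_eq_top_iff [simp]: "enn_powr a p = top \<longleftrightarrow> a = top"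
  by (cases a) (auto simp: enn_powr_def)

lemma measurable_enn_powr [measurable (raw)]:
  "f \<in> borel_measurable M \<Longrightarrow> (\<lambda>x. enn_powr (f x) p) \<in> borel_measurable M"
proof -
  assume [measurable]: "f \<in> borel_measurable M"
  have [measurable]: "Measurable.pred M (\<lambda>x. f x = \<infinity>)"
    using measurable_sets[OF \<open>f \<in> borel_measurable M\<close>, of "{\<infinity>}"]
    by (simp add: pred_def vimage_def Int_def conj_commute)
  show ?thesis
    unfolding enn_powr_def by measurable
qed

lemma enn_powr_mono: "a \<le> b \<Longrightarrow> 0 \<le> p \<Longrightarrow> enn_powr a p \<le> enn_powr b p"
  by (cases a; cases b) (auto simp: enn_powr_ennreal top_unique intro!: ennreal_leI powr_mono2)

lemma enn_powr_mult: "enn_powr (a * b) p = enn_powr a p * enn_powr b p"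
proof (cases "a = top \<or> b = top")
  case True
  then show ?thesis
    by (auto simp: ennreal_mult_top ennreal_top_mult)
next
  case False
  then show ?thesis
    by (cases a; cases b) (auto simp: enn_powr_ennreal powr_mult simp flip: ennreal_mult)
qed

lemma enn_powr_prod:
  "enn_powr (\<Prod>i\<in>I. g i) p = (\<Prod>i\<in>I. enn_powr (g i) p)"
  by (induction I rule: infinite_finite_induct) (auto simp: enn_powr_mult, auto simp: enn_powr_def)

lemma enn_powr_powr: "enn_powr (enn_powr a p) q = enn_powr a (p * q)"
  by (cases a) (auto simp: enn_powr_ennreal powr_powr)

lemma enn_powr_add: "enn_powr a p * enn_powr a q = enn_powr a (p + q)"
  by (cases a) (auto simp: enn_powr_ennreal powr_add simp flip: ennreal_mult)

text \<open>
  Jensen's inequality for the exponential function, applied to the logarithms of the \<open>x i\<close>.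
\<close>

lemma weighted_arith_geom_mean:
  fixes x :: "'i \<Rightarrow> real"
  assumes "finite I" "\<And>i. i \<in> I \<Longrightarrow> 0 \<le> x i" "\<And>i. i \<in> I \<Longrightarrow> 0 \<le> w i" "(\<Sum>i\<in>I. w i) = 1"
  shows "(\<Prod>i\<in>I. x i powr w i) \<le> (\<Sum>i\<in>I. w i * x i)"
proof (cases "\<exists>i\<in>I. x i = 0")
  case True
  then have "(\<Prod>i\<in>I. x i powr w i) = 0"
    using assms(1) by auto
  also have "0 \<le> (\<Sum>i\<in>I. w i * x i)"
    using assms by (simp add: sum_nonneg)
  finally show ?thesis .
next
  case False
  then have pos: "x i > 0" if "i \<in> I" for i
    using assms(2) that by (metis order_le_less)
  have "(\<Prod>i\<in>I. x i powr w i) = exp (\<Sum>i\<in>I. w i *\<^sub>R ln (x i))"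
    using False by (simp add: exp_sum[OF assms(1)] powr_def)
  also have "\<dots> \<le> (\<Sum>i\<in>I. w i * exp (ln (x i)))"
    using assms by (intro convex_on_sum[OF _ _ exp_convex]) auto
  also have "\<dots> = (\<Sum>i\<in>I. w i * x i)"
    using pos by simp
  finally show ?thesis .
qed

lemma weighted_arith_geom_mean_ennreal:
  assumes "finite I" "\<And>i. i \<in> I \<Longrightarrow> 0 < w i" "(\<Sum>i\<in>I. w i) = 1"
  shows "(\<Prod>i\<in>I. enn_powr (x i) (w i)) \<le> (\<Sum>i\<in>I. ennreal (w i) * x i)"
proof (cases "\<exists>i\<in>I. x i = top")
  case True
  then obtain i where i: "i \<in> I" "x i = top"
    by blast
  then have "(\<Sum>i\<in>I. ennreal (w i) * x i) = top"
    using assms(1) assms(2)[of i] by (auto simp: ennreal_mult_eq_top_iff intro!: bexI[of _ i])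
  then show ?thesis
    by simp
next
  case False
  define y where "y i = enn2real (x i)" for i
  have x: "x i = ennreal (y i)" if "i \<in> I" for i
    using False that by (auto simp: y_def less_top)
  have y: "0 \<le> y i" for i
    by (simp add: y_def)
  have "(\<Prod>i\<in>I. enn_powr (x i) (w i)) = ennreal (\<Prod>i\<in>I. y i powr w i)"
    by (simp add: x y enn_powr_ennreal prod_ennreal)
  also have "\<dots> \<le> ennreal (\<Sum>i\<in>I. w i * y i)"
    using assms y by (intro ennreal_leI weighted_arith_geom_mean) (auto simp: less_imp_le)
  also have "\<dots> = (\<Sum>i\<in>I. ennreal (w i) * x i)"
    using assms y by (subst sum_ennreal[symmetric]) (auto simp: x ennreal_mult less_imp_le)
  finally show ?thesis .
qed

text \<open>
  After dividing each \<open>f i\<close> by its integral, the inequality follows by integrating the weighted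
  arithmetic--geometric mean inequality pointwise.  Integrals equal to \<open>0\<close> or \<open>\<infinity>\<close> cannot be divided
  out: if one of them is \<open>0\<close>, both sides vanish; otherwise one that is \<open>\<infinity>\<close> makes the right-hand side
  infinite.
\<close>

lemma Hoelder_nn_integral:
  assumes I: "finite I" "\<And>i. i \<in> I \<Longrightarrow> 0 < w i" "(\<Sum>i\<in>I. w i) = 1"
    and f: "\<And>i. i \<in> I \<Longrightarrow> f i \<in> borel_measurable M"
  shows "(\<integral>\<^sup>+x. (\<Prod>i\<in>I. enn_powr (f i x) (w i)) \<partial>M) \<le> (\<Prod>i\<in>I. enn_powr (\<integral>\<^sup>+x. f i x \<partial>M) (w i))"
proof -
  define c where "c i = (\<integral>\<^sup>+x. f i x \<partial>M)" for i
  consider i where "i \<in> I" "c i = 0" | i where "i \<in> I" "c i = top" "\<forall>i\<in>I. c i \<noteq> 0"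
    | "\<forall>i\<in>I. c i \<noteq> 0 \<and> c i \<noteq> top"
    by blast
  then show ?thesis
  proof cases
    case (1 i)
    then have "AE x in M. f i x = 0"
      using f by (simp add: c_def nn_integral_0_iff_AE)
    then have "AE x in M. (\<Prod>i\<in>I. enn_powr (f i x) (w i)) = 0"
      by eventually_elim (use 1 I(1) in \<open>auto intro!: bexI[of _ i]\<close>)
    then have "(\<integral>\<^sup>+x. (\<Prod>i\<in>I. enn_powr (f i x) (w i)) \<partial>M) = 0"
      using f by (subst nn_integral_0_iff_AE) auto
    then show ?thesis
      by simp
  next
    case (2 i)
    then have "(\<Prod>i\<in>I. enn_powr (c i) (w i)) = top"
      using I(1) by (auto simp: ennreal_prod_eq_top)
    then show ?thesis
      by (simp add: c_def)
  next
    case 3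
    have scale: "c i * (f i x / c i) = f i x" if "i \<in> I" for i x
      using 3 that by (simp add: ennreal_times_divide mult.commute[of "c i"] mult_divide_eq_ennreal)
    have "(\<integral>\<^sup>+x. (\<Prod>i\<in>I. enn_powr (f i x) (w i)) \<partial>M)
        = (\<integral>\<^sup>+x. (\<Prod>i\<in>I. enn_powr (c i) (w i)) * (\<Prod>i\<in>I. enn_powr (f i x / c i) (w i)) \<partial>M)"
      by (simp add: prod.distrib[symmetric] enn_powr_mult[symmetric] scale cong: prod.cong)
    also have "\<dots> = (\<Prod>i\<in>I. enn_powr (c i) (w i)) * (\<integral>\<^sup>+x. (\<Prod>i\<in>I. enn_powr (f i x / c i) (w i)) \<partial>M)"
      using f by (subst nn_integral_cmult) auto
    also have "\<dots> \<le> (\<Prod>i\<in>I. enn_powr (c i) (w i)) * (\<integral>\<^sup>+x. (\<Sum>i\<in>I. ennreal (w i) * (f i x / c i)) \<partial>M)"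
      by (intro mult_left_mono nn_integral_mono weighted_arith_geom_mean_ennreal I) auto
    also have "(\<integral>\<^sup>+x. (\<Sum>i\<in>I. ennreal (w i) * (f i x / c i)) \<partial>M) = (\<Sum>i\<in>I. ennreal (w i) * (c i / c i))"
      using f by (simp add: nn_integral_sum nn_integral_cmult nn_integral_divide c_def)
    also have "\<dots> = (\<Sum>i\<in>I. ennreal (w i))"
      using 3 by (intro sum.cong) (auto simp: ennreal_divide_self less_top)
    also have "\<dots> = 1"
      using I by (subst sum_ennreal) (auto simp: less_imp_le)
    finally show ?thesis
      by (simp add: c_def)
  qed
qed

lemma Hoelder_nn_integral_two:
  assumes "0 < u" "0 < v" "u + v = 1" "f \<in> borel_measurable M" "g \<in> borel_measurable M"
  shows "(\<integral>\<^sup>+x. enn_powr (f x) u * enn_powr (g x) v \<partial>M)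
     \<le> enn_powr (\<integral>\<^sup>+x. f x \<partial>M) u * enn_powr (\<integral>\<^sup>+x. g x \<partial>M) v"
  using Hoelder_nn_integral[of "UNIV :: bool set" "\<lambda>b. if b then u else v" "\<lambda>b. if b then f else g" M] assms
  by (simp add: UNIV_bool mult.commute add.commute)

text \<open>
  Used to divide an estimate of \<open>X\<close> by the power of \<open>X\<close> on its right-hand side.  Finiteness of \<open>X\<close> is
  indispensable: \<open>X = \<infinity>\<close> satisfies the estimate for every \<open>P > 0\<close>.
\<close>

lemma enn_powr_absorb:
  assumes "X \<le> enn_powr X \<theta> * P" "X \<noteq> top" "\<theta> < 1"
  shows "enn_powr X (1 - \<theta>) \<le> P"
proof (cases "X = 0 \<or> P = top")
  case True
  then show ?thesis
    by auto
next
  case False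
  then obtain x p where x: "X = ennreal x" "0 < x" and p: "P = ennreal p" "0 \<le> p"
    using assms(2) by (cases X; cases P) (auto simp: less_le)
  have "ennreal x \<le> ennreal (x powr \<theta> * p)"
    using assms(1) x p by (simp add: enn_powr_ennreal ennreal_mult)
  then have "x \<le> x powr \<theta> * p"
    using p by (subst (asm) ennreal_le_iff) auto
  then have "x powr (1 - \<theta>) \<le> p"
    using x by (simp add: powr_diff divide_le_eq mult.commute)
  then show ?thesis
    using x by (simp add: enn_powr_ennreal p ennreal_leI)
qed

section \<open>The Loomis--Whitney inequality\<close>

text \<open>
  The line integral of \<open>f i\<close> in direction \<open>i\<close> is a function of the other coordinates only.  The extra
  factor \<open>h\<close>, which depends on all coordinates, makes the statement meaningful for a single
  coordinate, where it is an equality, and makes it reproduce itself in the induction: when a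
  coordinate \<open>j\<close> is added, \<open>h\<close> with \<open>j\<close> frozen is again such a factor, while the line integral of
  \<open>f j\<close> does not depend on coordinate \<open>j\<close> and is split off by Hoelder's inequality with exponents
  \<open>(n+1)/n\<close> and \<open>n+1\<close>.  A second use of Hoelder's inequality, with \<open>n+1\<close> equal exponents,
  integrates over coordinate \<open>j\<close>.
\<close>

lemma loomis_whitney_PiM:
  fixes f :: "'i \<Rightarrow> ('i \<Rightarrow> real) \<Rightarrow> ennreal"
  assumes "finite I" "I \<noteq> {}"
    and "\<And>i. i \<in> I \<Longrightarrow> f i \<in> borel_measurable (Pi\<^sub>M I (\<lambda>_. lborel))"
    and "h \<in> borel_measurable (Pi\<^sub>M I (\<lambda>_. lborel))"
  defines "r \<equiv> 1 / real (card I)"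
  shows "(\<integral>\<^sup>+x. enn_powr (h x) r * (\<Prod>i\<in>I. enn_powr (\<integral>\<^sup>+s. f i (x(i := s)) \<partial>lborel) r)
            \<partial>(Pi\<^sub>M I (\<lambda>_. lborel)))
    \<le> enn_powr (\<integral>\<^sup>+x. h x \<partial>Pi\<^sub>M I (\<lambda>_. lborel)) r * (\<Prod>i\<in>I. enn_powr (\<integral>\<^sup>+x. f i x \<partial>Pi\<^sub>M I (\<lambda>_. lborel)) r)"
  using assms(1-4) unfolding r_def
proof (induction I arbitrary: f h rule: finite_ne_induct)
  case (singleton i)
  interpret product_sigma_finite "\<lambda>_::'i. lborel :: real measure"
    by standard
  note [measurable] = singleton(1)[OF singletonI] singleton(2)
  have eq: "integral\<^sup>N (Pi\<^sub>M {i} (\<lambda>_. lborel)) g = (\<integral>\<^sup>+y. g ((\<lambda>_. undefined)(i := y)) \<partial>lborel)"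
    if "g \<in> borel_measurable (Pi\<^sub>M {i} (\<lambda>_. lborel))" for g :: "('i \<Rightarrow> real) \<Rightarrow> ennreal"
    using product_nn_integral_insert[of "{}" i g] that
    by (simp add: PiM_empty nn_integral_count_space_finite fun_upd_def)
  have m: "(\<lambda>y. h ((\<lambda>_. undefined)(i := y))) \<in> borel_measurable lborel"
    by (rule measurable_compose[OF measurable_component_update]) (auto simp: space_PiM)
  have "(\<integral>\<^sup>+x. h x * (\<integral>\<^sup>+s. f i (x(i := s)) \<partial>lborel) \<partial>Pi\<^sub>M {i} (\<lambda>_. lborel))
      = (\<integral>\<^sup>+x. h x * (\<integral>\<^sup>+s. f i ((\<lambda>_. undefined)(i := s)) \<partial>lborel) \<partial>Pi\<^sub>M {i} (\<lambda>_. lborel))"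
  proof (intro nn_integral_cong)
    fix x assume "x \<in> space (Pi\<^sub>M {i} (\<lambda>_. lborel :: real measure))"
    then have "x(i := s) = (\<lambda>_. undefined)(i := s)" for s
      by (auto simp: space_PiM PiE_def extensional_def fun_eq_iff)
    then show "h x * (\<integral>\<^sup>+s. f i (x(i := s)) \<partial>lborel) = h x * (\<integral>\<^sup>+s. f i ((\<lambda>_. undefined)(i := s)) \<partial>lborel)"
      by simp
  qed
  also have "\<dots> = (\<integral>\<^sup>+x. h x \<partial>Pi\<^sub>M {i} (\<lambda>_. lborel)) * (\<integral>\<^sup>+x. f i x \<partial>Pi\<^sub>M {i} (\<lambda>_. lborel))"
    by (simp add: nn_integral_multc eq)
  finally show ?case
    by (simp add: fun_upd_def)
next
  case (insert j I)
  interpret product_sigma_finite "\<lambda>_::'i. lborel :: real measure"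
    by standard
  interpret finite_product_sigma_finite "\<lambda>_::'i. lborel :: real measure" I
    by standard (rule insert)
  let ?P = "Pi\<^sub>M I (\<lambda>_. lborel :: real measure)" and ?P' = "Pi\<^sub>M (insert j I) (\<lambda>_. lborel :: real measure)"
  note [measurable] = insert.prems(2)
  have [measurable]: "f i \<in> borel_measurable ?P'" if "i \<in> insert j I" for i
    using insert.prems(1) that .
  have [measurable]: "f j \<in> borel_measurable ?P'"
    by simp
  define n where "n = real (card I)"
  have n: "n > 0"
    using insert by (simp add: n_def card_gt_0_iff)
  have card: "real (card (insert j I)) = n + 1"
    using insert by (simp add: n_def)
  define u where "u = n / (n + 1)"
  define v where "v = 1 / (n + 1)"
  have uv: "0 < u" "0 < v" "u + v = 1" "1 / n * u = v"
    using n by (auto simp: u_def v_def field_simps)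
  define K where "K y x = enn_powr (h (x(j := y))) (1 / n) *
     (\<Prod>i\<in>I. enn_powr (\<integral>\<^sup>+s. f i ((x(i := s))(j := y)) \<partial>lborel) (1 / n))" for y x
  define J where "J x = (\<integral>\<^sup>+s. f j (x(j := s)) \<partial>lborel)" for x
  \<comment> \<open>The index \<open>j\<close> of \<open>\<phi>\<close> is free for \<open>h\<close>, since \<open>f j\<close> is handled by \<open>J\<close>.\<close>
  define \<phi> where "\<phi> i y = (\<integral>\<^sup>+x. (if i = j then h else f i) (x(j := y)) \<partial>?P)" for i y
  have fi: "(\<lambda>x. f i (x(j := y))) \<in> borel_measurable ?P" if "i \<in> insert j I" for i y
    using insert.prems(1)[OF that] by measurable
  have hm: "(\<lambda>x. h (x(j := y))) \<in> borel_measurable ?P" for y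
    by measurable
  have fi2: "(\<lambda>x. \<integral>\<^sup>+s. f i (x(i := s)) \<partial>lborel) \<in> borel_measurable ?P'" if "i \<in> insert j I" for i
  proof -
    have [measurable]: "(\<lambda>(x, s). x(i := s)) \<in> measurable (?P' \<Otimes>\<^sub>M lborel) ?P'"
      using measurable_add_dim[of i "insert j I" "\<lambda>_. lborel :: real measure"]
      by (simp only: insert_absorb[OF that])
    note insert.prems(1)[OF that, measurable]
    show ?thesis
      by measurable
  qed
  have fi3: "(\<lambda>x. \<integral>\<^sup>+s. f i ((x(i := s))(j := y)) \<partial>lborel) \<in> borel_measurable ?P" if "i \<in> I" for i y
  proof -
    have "i \<noteq> j" using that insert by auto
    then have "(\<lambda>x. \<integral>\<^sup>+s. f i ((x(i := s))(j := y)) \<partial>lborel) = (\<lambda>x. \<integral>\<^sup>+s. f i ((x(j := y))(i := s)) \<partial>lborel)"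
      by (simp add: fun_upd_twist)
    also have "\<dots> \<in> borel_measurable ?P"
      by (rule measurable_compose[OF _ fi2]) (use that in auto)
    finally show ?thesis .
  qed
  have K_meas: "K y \<in> borel_measurable ?P" for y
    unfolding K_def using fi3 by measurable
  have J_meas: "J \<in> borel_measurable ?P"
    unfolding J_def by measurable
  have J_int: "(\<integral>\<^sup>+x. J x \<partial>?P) = (\<integral>\<^sup>+x. f j x \<partial>?P')"
    unfolding J_def using insert by (subst product_nn_integral_insert) auto
  have \<phi>_meas: "\<phi> i \<in> borel_measurable lborel" if "i \<in> insert j I" for i
    unfolding \<phi>_def using insert.prems(1)[OF that] by (cases "i = j") auto
  have \<phi>_int: "(\<integral>\<^sup>+y. \<phi> i y \<partial>lborel) = (\<integral>\<^sup>+x. (if i = j then h else f i) x \<partial>?P')" if "i \<in> insert j I" for i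
    unfolding \<phi>_def using insert insert.prems(1)[OF that]
    by (subst product_nn_integral_insert_rev) auto
  have inner: "(\<integral>\<^sup>+x. enn_powr (K y x) u * enn_powr (J x) v \<partial>?P)
      \<le> (\<Prod>i\<in>insert j I. enn_powr (\<phi> i y) v) * enn_powr (\<integral>\<^sup>+x. f j x \<partial>?P') v" for y
  proof -
    have "(\<integral>\<^sup>+x. K y x \<partial>?P) \<le> enn_powr (\<phi> j y) (1 / n) * (\<Prod>i\<in>I. enn_powr (\<integral>\<^sup>+x. f i (x(j := y)) \<partial>?P) (1 / n))"
      using insert.IH[of "\<lambda>i x. f i (x(j := y))" "\<lambda>x. h (x(j := y))", OF fi[OF insertI2] hm]
      by (simp add: K_def \<phi>_def n_def fun_upd_def)
    also have "\<dots> = (\<Prod>i\<in>insert j I. enn_powr (\<phi> i y) (1 / n))"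
    proof -
      have "\<phi> i y = (\<integral>\<^sup>+x. f i (x(j := y)) \<partial>?P)" if "i \<in> I" for i
        using that insert.hyps by (auto simp: \<phi>_def)
      then show ?thesis
        using insert.hyps by simp
    qed
    finally have "enn_powr (\<integral>\<^sup>+x. K y x \<partial>?P) u \<le> enn_powr (\<Prod>i\<in>insert j I. enn_powr (\<phi> i y) (1 / n)) u"
      by (rule enn_powr_mono) (use uv in simp)
    also have "\<dots> = (\<Prod>i\<in>insert j I. enn_powr (\<phi> i y) v)"
      by (simp only: enn_powr_prod enn_powr_powr uv)
    finally have K: "enn_powr (\<integral>\<^sup>+x. K y x \<partial>?P) u \<le> \<dots>" .
    have "(\<integral>\<^sup>+x. enn_powr (K y x) u * enn_powr (J x) v \<partial>?P)
      \<le> enn_powr (\<integral>\<^sup>+x. K y x \<partial>?P) u * enn_powr (\<integral>\<^sup>+x. J x \<partial>?P) v"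
      by (rule Hoelder_nn_integral_two[OF uv(1-3) K_meas J_meas])
    also have "\<dots> \<le> (\<Prod>i\<in>insert j I. enn_powr (\<phi> i y) v) * enn_powr (\<integral>\<^sup>+x. f j x \<partial>?P') v"
      unfolding J_int by (intro mult_right_mono K) simp
    finally show ?thesis .
  qed
  have "(\<integral>\<^sup>+x. enn_powr (h x) v * (\<Prod>i\<in>insert j I. enn_powr (\<integral>\<^sup>+s. f i (x(i := s)) \<partial>lborel) v) \<partial>?P')
     = (\<integral>\<^sup>+y. \<integral>\<^sup>+x. enn_powr (h (x(j := y))) v *
          (\<Prod>i\<in>insert j I. enn_powr (\<integral>\<^sup>+s. f i ((x(j := y))(i := s)) \<partial>lborel) v) \<partial>?P \<partial>lborel)"
    using insert fi2 by (intro product_nn_integral_insert_rev) auto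
  also have "\<dots> = (\<integral>\<^sup>+y. \<integral>\<^sup>+x. enn_powr (K y x) u * enn_powr (J x) v \<partial>?P \<partial>lborel)"
  proof (intro nn_integral_cong)
    fix y x
    have "(\<Prod>i\<in>I. enn_powr (\<integral>\<^sup>+s. f i ((x(j := y))(i := s)) \<partial>lborel) v)
       = (\<Prod>i\<in>I. enn_powr (\<integral>\<^sup>+s. f i ((x(i := s))(j := y)) \<partial>lborel) v)"
      by (intro prod.cong refl) (use insert in \<open>metis fun_upd_twist\<close>)
    then show "enn_powr (h (x(j := y))) v *
          (\<Prod>i\<in>insert j I. enn_powr (\<integral>\<^sup>+s. f i ((x(j := y))(i := s)) \<partial>lborel) v)
       = enn_powr (K y x) u * enn_powr (J x) v"
      using insert by (simp add: K_def J_def enn_powr_mult enn_powr_prod enn_powr_powr uv(4)[simplified] ac_simps)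
  qed
  also have "\<dots> \<le> (\<integral>\<^sup>+y. (\<Prod>i\<in>insert j I. enn_powr (\<phi> i y) v) * enn_powr (\<integral>\<^sup>+x. f j x \<partial>?P') v \<partial>lborel)"
    by (intro nn_integral_mono inner)
  also have "\<dots> = (\<integral>\<^sup>+y. (\<Prod>i\<in>insert j I. enn_powr (\<phi> i y) v) \<partial>lborel) * enn_powr (\<integral>\<^sup>+x. f j x \<partial>?P') v"
    using \<phi>_meas by (intro nn_integral_multc) auto
  also have "\<dots> \<le> (\<Prod>i\<in>insert j I. enn_powr (\<integral>\<^sup>+y. \<phi> i y \<partial>lborel) v) * enn_powr (\<integral>\<^sup>+x. f j x \<partial>?P') v"
    using \<phi>_meas uv insert n
    by (intro mult_right_mono Hoelder_nn_integral) (auto simp: card v_def, simp add: n_def field_simps)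
  also have "\<dots> = enn_powr (\<integral>\<^sup>+x. h x \<partial>?P') v * (\<Prod>i\<in>insert j I. enn_powr (\<integral>\<^sup>+x. f i x \<partial>?P') v)"
  proof -
    have "(\<Prod>i\<in>I. enn_powr (\<integral>\<^sup>+y. \<phi> i y \<partial>lborel) v) = (\<Prod>i\<in>I. enn_powr (\<integral>\<^sup>+x. f i x \<partial>?P') v)"
      using insert by (intro prod.cong refl, subst \<phi>_int) auto
    then show ?thesis
      using insert by (simp add: \<phi>_int ac_simps)
  qed
  finally show ?case
    unfolding card v_def .
qed

lemma nn_integral_lborel_PiM:
  fixes f :: "'a::euclidean_space \<Rightarrow> ennreal"
  assumes "f \<in> borel_measurable borel"
  shows "(\<integral>\<^sup>+x. f x \<partial>lborel) = (\<integral>\<^sup>+x. f (\<Sum>b\<in>Basis. x b *\<^sub>R b) \<partial>Pi\<^sub>M Basis (\<lambda>_. lborel))"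
  by (subst lborel_eq) (use assms in \<open>simp add: nn_integral_distr\<close>)

lemma sum_Basis_fun_upd:
  fixes b :: "'a::euclidean_space"
  assumes "b \<in> Basis" "X = (\<Sum>c\<in>Basis. x c *\<^sub>R c)"
  shows "(\<Sum>c\<in>Basis. (x(b := s)) c *\<^sub>R c) = X + (s - X \<bullet> b) *\<^sub>R b"
proof (rule euclidean_eqI)
  fix d :: 'a assume "d \<in> Basis"
  then show "(\<Sum>c\<in>Basis. (x(b := s)) c *\<^sub>R c) \<bullet> d = (X + (s - X \<bullet> b) *\<^sub>R b) \<bullet> d"
    using assms by (simp add: inner_add_left inner_sum_left_Basis inner_Basis)
qed

text \<open>
  The point \<open>x + (s - x \<bullet> b) *\<^sub>R b\<close> is \<open>x\<close> with its \<open>b\<close>-coordinate replaced by \<open>s\<close>, so this is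
  \<open>loomis_whitney_PiM\<close> in the coordinates of the standard basis.
\<close>

lemma loomis_whitney_lborel:
  fixes f :: "'a::euclidean_space \<Rightarrow> 'a \<Rightarrow> ennreal"
  assumes f: "\<And>b. b \<in> Basis \<Longrightarrow> f b \<in> borel_measurable borel" and h: "h \<in> borel_measurable borel"
  defines "r \<equiv> 1 / real DIM('a)"
  shows "(\<integral>\<^sup>+x. enn_powr (h x) r *
             (\<Prod>b\<in>Basis. enn_powr (\<integral>\<^sup>+s. f b (x + (s - x \<bullet> b) *\<^sub>R b) \<partial>lborel) r) \<partial>lborel)
    \<le> enn_powr (\<integral>\<^sup>+x. h x \<partial>lborel) r * (\<Prod>b\<in>Basis. enn_powr (\<integral>\<^sup>+x. f b x \<partial>lborel) r)"
proof -
  let ?S = "\<lambda>x::'a \<Rightarrow> real. \<Sum>b\<in>Basis. x b *\<^sub>R b"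
  have fS: "(\<lambda>x. f b (?S x)) \<in> borel_measurable (Pi\<^sub>M Basis (\<lambda>_. lborel))" if "b \<in> Basis" for b
    using f[OF that] by measurable
  have hS: "(\<lambda>x. h (?S x)) \<in> borel_measurable (Pi\<^sub>M Basis (\<lambda>_. lborel))"
    using h by measurable
  have line: "(\<lambda>x. \<integral>\<^sup>+s. f b (x + (s - x \<bullet> b) *\<^sub>R b) \<partial>lborel) \<in> borel_measurable borel" if "b \<in> Basis" for b
    using f[OF that] by measurable
  have "(\<integral>\<^sup>+x. enn_powr (h x) r *
             (\<Prod>b\<in>Basis. enn_powr (\<integral>\<^sup>+s. f b (x + (s - x \<bullet> b) *\<^sub>R b) \<partial>lborel) r) \<partial>lborel)
     = (\<integral>\<^sup>+x. enn_powr (h (?S x)) r *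
             (\<Prod>b\<in>Basis. enn_powr (\<integral>\<^sup>+s. f b (?S x + (s - ?S x \<bullet> b) *\<^sub>R b) \<partial>lborel) r)
           \<partial>Pi\<^sub>M Basis (\<lambda>_. lborel))"
    by (rule nn_integral_lborel_PiM) (use h line in measurable)
  also have "\<dots> = (\<integral>\<^sup>+x. enn_powr (h (?S x)) r *
             (\<Prod>b\<in>Basis. enn_powr (\<integral>\<^sup>+s. f b (?S (x(b := s))) \<partial>lborel) r)
           \<partial>Pi\<^sub>M Basis (\<lambda>_. lborel))"
    by (intro nn_integral_cong arg_cong2[where f = "(*)"] prod.cong refl) (simp only: sum_Basis_fun_upd)
  also have "\<dots> \<le> enn_powr (\<integral>\<^sup>+x. h (?S x) \<partial>Pi\<^sub>M Basis (\<lambda>_. lborel)) r *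
      (\<Prod>b\<in>Basis. enn_powr (\<integral>\<^sup>+x. f b (?S x) \<partial>Pi\<^sub>M Basis (\<lambda>_. lborel)) r)"
    unfolding r_def using loomis_whitney_PiM[of Basis "\<lambda>b x. f b (?S x)" "\<lambda>x. h (?S x)"] fS hS
    by simp
  also have "\<dots> = enn_powr (\<integral>\<^sup>+x. h x \<partial>lborel) r * (\<Prod>b\<in>Basis. enn_powr (\<integral>\<^sup>+x. f b x \<partial>lborel) r)"
    using f h by (simp add: nn_integral_lborel_PiM cong: prod.cong)
  finally show ?thesis .
qed

text \<open>
  Tonelli's theorem: it suffices to compare integrals over all lines in one coordinate direction.
\<close>

lemma nn_integral_mono_lines:
  fixes u v :: "'a::euclidean_space \<Rightarrow> ennreal"
  assumes b: "b \<in> Basis" and u: "u \<in> borel_measurable borel" and v: "v \<in> borel_measurable borel"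
    and le: "\<And>x. (\<integral>\<^sup>+s. u (x + (s - x \<bullet> b) *\<^sub>R b) \<partial>lborel) \<le> (\<integral>\<^sup>+s. v (x + (s - x \<bullet> b) *\<^sub>R b) \<partial>lborel)"
  shows "(\<integral>\<^sup>+x. u x \<partial>lborel) \<le> (\<integral>\<^sup>+x. v x \<partial>lborel)"
proof -
  interpret product_sigma_finite "\<lambda>_::'a. lborel :: real measure"
    by standard
  let ?S = "\<lambda>x::'a \<Rightarrow> real. \<Sum>b\<in>Basis. x b *\<^sub>R b"
  let ?P = "Pi\<^sub>M (Basis - {b}) (\<lambda>_. lborel :: real measure)"
  have B: "insert b (Basis - {b}) = Basis"
    using b by blast
  have split: "(\<integral>\<^sup>+x. g x \<partial>lborel) = (\<integral>\<^sup>+x. \<integral>\<^sup>+s. g (?S x + (s - ?S x \<bullet> b) *\<^sub>R b) \<partial>lborel \<partial>?P)"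
    if g: "g \<in> borel_measurable borel" for g :: "'a \<Rightarrow> ennreal"
  proof -
    have "(\<lambda>x. g (?S x)) \<in> borel_measurable (Pi\<^sub>M Basis (\<lambda>_. lborel))"
      using g by measurable
    then have "(\<integral>\<^sup>+x. g x \<partial>lborel) = (\<integral>\<^sup>+x. \<integral>\<^sup>+s. g (?S (x(b := s))) \<partial>lborel \<partial>?P)"
      unfolding nn_integral_lborel_PiM[OF g]
      by (intro product_nn_integral_insert[of "Basis - {b}" b "\<lambda>x. g (?S x)", unfolded B]) auto
    then show ?thesis
      by (simp only: sum_Basis_fun_upd[OF b])
  qed
  show ?thesis
    unfolding split[OF u] split[OF v] by (intro nn_integral_mono le)
qed

section \<open>Weighted inequalities on a half line\<close>

lemma nn_integral_indicator_Icc: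
  fixes f :: "real \<Rightarrow> real"
  assumes "continuous_on {c..d} f" "\<And>s. s \<in> {c..d} \<Longrightarrow> 0 \<le> f s"
  shows "(\<integral>\<^sup>+s. ennreal (indicator {c..d} s * f s) \<partial>lborel) = ennreal (integral {c..d} f)"
  using integrable_integral[OF integrable_continuous_interval[OF assms(1)]] assms(2)
  by (intro nn_integral_has_integral_lebesgue) auto

text \<open>
  The fundamental theorem of calculus for \<open>s\<^sup>a G(s)\<close>, whose derivative is
  \<open>a s\<^bsup>a-1\<^esup> G + s\<^sup>a G'\<close>.  Both inequalities below come from it, by choosing the end point at
  which the boundary term vanishes.
\<close>

lemma weighted_FTC:
  fixes G G' :: "real \<Rightarrow> real" and a c d :: real
  assumes G: "\<And>s. (G has_real_derivative G' s) (at s)" and G': "continuous_on UNIV G'"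
    and cd: "0 < c" "c \<le> d"
  defines "H \<equiv> integral {c..d} (\<lambda>s. s powr (a - 1) * G s)"
    and "E \<equiv> integral {c..d} (\<lambda>s. s powr a * \<bar>G' s\<bar>)"
  shows "\<bar>(d powr a * G d - c powr a * G c) - a * H\<bar> \<le> E"
proof -
  have contG: "continuous_on S G" for S
    using G by (meson DERIV_isCont continuous_at_imp_continuous_on)
  have contG': "continuous_on S G'" for S
    using G' continuous_on_subset by blast
  have i1: "(\<lambda>s. s powr (a - 1) * G s) integrable_on {c..d}"
    using cd by (intro integrable_continuous_interval continuous_intros contG) auto
  have i2: "(\<lambda>s. s powr a * G' s) integrable_on {c..d}"
    using cd by (intro integrable_continuous_interval continuous_intros contG') auto
  have i3: "(\<lambda>s. s powr a * \<bar>G' s\<bar>) integrable_on {c..d}"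
    using cd by (intro integrable_continuous_interval continuous_intros contG') auto
  have "((\<lambda>s. a * (s powr (a - 1) * G s) + s powr a * G' s) has_integral
          (d powr a * G d - c powr a * G c)) {c..d}"
  proof (rule fundamental_theorem_of_calculus[OF cd(2)])
    fix s assume s: "s \<in> {c..d}"
    have "((\<lambda>s. s powr a * G s) has_real_derivative a * (s powr (a - 1) * G s) + s powr a * G' s) (at s)"
      using s cd by (auto intro!: derivative_eq_intros G)
    then show "((\<lambda>s. s powr a * G s) has_vector_derivative a * (s powr (a - 1) * G s) + s powr a * G' s)
        (at s within {c..d})"
      by (simp add: has_real_derivative_iff_has_vector_derivative has_vector_derivative_at_within)
  qed
  moreover have "((\<lambda>s. a * (s powr (a - 1) * G s) + s powr a * G' s) has_integral
      (a * H + integral {c..d} (\<lambda>s. s powr a * G' s))) {c..d}"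
    unfolding H_def by (intro has_integral_add has_integral_mult_right integrable_integral i1 i2)
  ultimately have eq: "d powr a * G d - c powr a * G c = a * H + integral {c..d} (\<lambda>s. s powr a * G' s)"
    by (rule has_integral_unique)
  have "\<bar>integral {c..d} (\<lambda>s. s powr a * G' s)\<bar> \<le> E"
    unfolding E_def using integral_norm_bound_integral[OF i2 i3] by (simp add: abs_mult)
  then show ?thesis
    by (simp add: eq)
qed

lemma sup_le_integral_deriv:
  fixes G G' :: "real \<Rightarrow> real" and t R :: real
  assumes G: "\<And>s. (G has_real_derivative G' s) (at s)" and G': "continuous_on UNIV G'"
    and supp: "\<And>s. R \<le> \<bar>s\<bar> \<Longrightarrow> G s = 0"
  shows "ennreal (G t) \<le> (\<integral>\<^sup>+s. ennreal \<bar>G' s\<bar> \<partial>lborel)"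
proof -
  define c where "c = min t (-\<bar>R\<bar>)"
  have c: "c \<le> t" "G c = 0"
    using supp[of c] by (auto simp: c_def)
  have "(G' has_integral (G t - G c)) {c..t}"
    using G by (intro fundamental_theorem_of_calculus c)
      (simp add: has_real_derivative_iff_has_vector_derivative has_vector_derivative_at_within)
  then have "G t = integral {c..t} G'"
    using c by (simp add: integral_unique)
  also have "\<dots> \<le> integral {c..t} (\<lambda>s. \<bar>G' s\<bar>)"
    by (intro integral_le integrable_continuous_interval continuous_intros continuous_on_subset[OF G']) auto
  finally have "ennreal (G t) \<le> ennreal (integral {c..t} (\<lambda>s. \<bar>G' s\<bar>))"
    by (rule ennreal_leI)
  also have "\<dots> = (\<integral>\<^sup>+s. ennreal (indicator {c..t} s * \<bar>G' s\<bar>) \<partial>lborel)"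
    by (intro nn_integral_indicator_Icc[symmetric] continuous_intros continuous_on_subset[OF G']) auto
  also have "\<dots> \<le> (\<integral>\<^sup>+s. ennreal \<bar>G' s\<bar> \<partial>lborel)"
    by (intro nn_integral_mono) (auto simp: indicator_def)
  finally show ?thesis .
qed

lemma integral_le_nn_integral_halfline:
  fixes G' :: "real \<Rightarrow> real" and a c d \<delta> :: real
  assumes G': "continuous_on UNIV G'" and \<delta>: "0 < \<delta>" and "\<delta> \<le> c"
  shows "ennreal (integral {c..d} (\<lambda>s. s powr a * \<bar>G' s\<bar>))
     \<le> (\<integral>\<^sup>+s. ennreal (indicator {\<delta><..} s * (s powr a * \<bar>G' s\<bar>)) \<partial>lborel)"
proof -
  have "ennreal (integral {c..d} (\<lambda>s. s powr a * \<bar>G' s\<bar>))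
     = (\<integral>\<^sup>+s. ennreal (indicator {c..d} s * (s powr a * \<bar>G' s\<bar>)) \<partial>lborel)"
    using \<delta> assms by (intro nn_integral_indicator_Icc[symmetric] continuous_intros continuous_on_subset[OF G']) auto
  also have "\<dots> \<le> (\<integral>\<^sup>+s. ennreal (indicator {\<delta><..} s * (s powr a * \<bar>G' s\<bar>)) \<partial>lborel)"
    by (intro nn_integral_mono_AE, use AE_lborel_singleton[of \<delta>] in eventually_elim)
       (use assms in \<open>auto simp: indicator_def\<close>)
  finally show ?thesis .
qed

context
  fixes G G' :: "real \<Rightarrow> real" and \<delta> a R :: real
  assumes G: "\<And>s. (G has_real_derivative G' s) (at s)" and G': "continuous_on UNIV G'"
    and nonneg: "\<And>s. 0 \<le> G s" and \<delta>: "0 < \<delta>"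
    and supp: "\<And>s. R \<le> \<bar>s\<bar> \<Longrightarrow> G s = 0"
    and bdry: "0 < a \<or> G \<delta> = 0"
begin

text \<open>
  For \<open>a > 0\<close> the interval from \<open>t\<close> to beyond the support is used, otherwise the interval from
  \<open>\<delta>\<close> to \<open>t\<close>; in either case the term with \<open>a s\<^bsup>a-1\<^esup> G\<close> has the favourable sign.
\<close>

lemma weighted_sup_le:
  assumes "\<delta> < t"
  shows "ennreal (t powr a * G t) \<le> (\<integral>\<^sup>+s. ennreal (indicator {\<delta><..} s * (s powr a * \<bar>G' s\<bar>)) \<partial>lborel)"
proof -
  have contG: "continuous_on S G" for S
    using G by (meson DERIV_isCont continuous_at_imp_continuous_on)
  obtain c d where cd: "\<delta> \<le> c" "c \<le> d"
    "t powr a * G t \<le> integral {c..d} (\<lambda>s. s powr a * \<bar>G' s\<bar>)"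
  proof (cases "0 < a")
    case True
    define d where "d = max t R"
    have "0 \<le> a * integral {t..d} (\<lambda>s. s powr (a - 1) * G s)"
      using assms \<delta> nonneg True
      by (intro mult_nonneg_nonneg integral_nonneg integrable_continuous_interval continuous_intros contG) (auto simp: d_def)
    moreover have "G d = 0"
      using supp[of d] by (simp add: d_def)
    ultimately show ?thesis
      using weighted_FTC[OF G G', of t d a] assms \<delta> True
      by (intro that[of t d]) (auto simp: d_def abs_le_iff)
  next
    case False
    have "0 \<le> integral {\<delta>..t} (\<lambda>s. s powr (a - 1) * G s)"
      using assms \<delta> nonneg
      by (intro integral_nonneg integrable_continuous_interval continuous_intros contG) auto
    then have "a * integral {\<delta>..t} (\<lambda>s. s powr (a - 1) * G s) \<le> 0"
      using False by (simp add: mult_nonpos_nonneg)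
    then show ?thesis
      using weighted_FTC[OF G G', of \<delta> t a] assms \<delta> False bdry
      by (intro that[of \<delta> t]) (auto simp: abs_le_iff)
  qed
  then show ?thesis
    using integral_le_nn_integral_halfline[OF G' \<delta> cd(1), where d = d] by (meson ennreal_leI order_trans)
qed

text \<open>
  For \<open>a > 0\<close> the boundary term \<open>\<delta>\<^sup>a G(\<delta>)\<close> has the favourable sign, for \<open>a < 0\<close> it has to vanish.
\<close>

lemma Hardy_halfline:
  shows "ennreal \<bar>a\<bar> * (\<integral>\<^sup>+s. ennreal (indicator {\<delta><..} s * (s powr (a - 1) * G s)) \<partial>lborel)
     \<le> (\<integral>\<^sup>+s. ennreal (indicator {\<delta><..} s * (s powr a * \<bar>G' s\<bar>)) \<partial>lborel)"
proof -
  have contG: "continuous_on S G" for S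
    using G by (meson DERIV_isCont continuous_at_imp_continuous_on)
  define d where "d = max \<delta> R"
  have d: "\<delta> \<le> d" "G d = 0"
    using supp[of d] \<delta> by (auto simp: d_def)
  let ?H = "integral {\<delta>..d} (\<lambda>s. s powr (a - 1) * G s)"
  have "(\<integral>\<^sup>+s. ennreal (indicator {\<delta><..} s * (s powr (a - 1) * G s)) \<partial>lborel)
     \<le> (\<integral>\<^sup>+s. ennreal (indicator {\<delta>..d} s * (s powr (a - 1) * G s)) \<partial>lborel)"
  proof (intro nn_integral_mono)
    fix s
    have "s > d \<Longrightarrow> G s = 0"
      using supp[of s] \<delta> by (auto simp: d_def)
    then show "ennreal (indicator {\<delta><..} s * (s powr (a - 1) * G s)) \<le> ennreal (indicator {\<delta>..d} s * (s powr (a - 1) * G s))"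
      using nonneg by (auto simp: indicator_def)
  qed
  also have "\<dots> = ennreal ?H"
    using \<delta> nonneg by (intro nn_integral_indicator_Icc continuous_intros contG) auto
  finally have "ennreal \<bar>a\<bar> * (\<integral>\<^sup>+s. ennreal (indicator {\<delta><..} s * (s powr (a - 1) * G s)) \<partial>lborel)
     \<le> ennreal \<bar>a\<bar> * ennreal ?H"
    by (rule mult_left_mono) simp
  also have "\<dots> = ennreal (\<bar>a\<bar> * ?H)"
    by (simp add: ennreal_mult')
  also have "\<dots> \<le> ennreal (integral {\<delta>..d} (\<lambda>s. s powr a * \<bar>G' s\<bar>))"
  proof (rule ennreal_leI)
    have "0 \<le> \<delta> powr a * G \<delta>"
      using nonneg by simp
    then show "\<bar>a\<bar> * ?H \<le> integral {\<delta>..d} (\<lambda>s. s powr a * \<bar>G' s\<bar>)"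
      using weighted_FTC[OF G G' \<delta> d(1), of a] d(2) bdry
      by (cases "0 < a") (auto simp: abs_le_iff abs_of_nonpos)
  qed
  also have "\<dots> \<le> (\<integral>\<^sup>+s. ennreal (indicator {\<delta><..} s * (s powr a * \<bar>G' s\<bar>)) \<partial>lborel)"
    by (rule integral_le_nn_integral_halfline[OF G' \<delta>]) simp
  finally show ?thesis .
qed

end

section \<open>Integrals over truncated half spaces\<close>

definition trunc_integral :: "'a::euclidean_space \<Rightarrow> real \<Rightarrow> real \<Rightarrow> ('a \<Rightarrow> real) \<Rightarrow> ennreal" where
  "trunc_integral e \<delta> w \<phi> =
     (\<integral>\<^sup>+x. ennreal (indicator {\<delta><..} (x \<bullet> e) * ((x \<bullet> e) powr w * \<phi> x)) \<partial>lborel)"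

lemma trunc_integral_finite:
  fixes \<phi> :: "'a::euclidean_space \<Rightarrow> real"
  assumes cont: "continuous_on UNIV \<phi>" and nonneg: "\<And>x. 0 \<le> \<phi> x" and supp: "\<And>x. R \<le> norm x \<Longrightarrow> \<phi> x = 0"
    and e: "e \<in> Basis" and \<delta>: "0 < \<delta>"
  shows "trunc_integral e \<delta> w \<phi> \<noteq> top"
proof -
  have "bounded (\<phi> ` cball 0 R)"
    by (intro compact_imp_bounded compact_continuous_image continuous_on_subset[OF cont]) auto
  then obtain M where M: "0 < M" "\<And>x. x \<in> cball 0 R \<Longrightarrow> \<bar>\<phi> x\<bar> \<le> M"
    unfolding bounded_pos by auto
  let ?K = "(\<delta> powr w + R powr w) * M"
  have "trunc_integral e \<delta> w \<phi> \<le> (\<integral>\<^sup>+x. ennreal ?K * indicator (cball 0 R) x \<partial>(lborel :: 'a measure))"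
    unfolding trunc_integral_def
  proof (intro nn_integral_mono)
    fix x :: 'a
    show "ennreal (indicator {\<delta><..} (x \<bullet> e) * ((x \<bullet> e) powr w * \<phi> x)) \<le> ennreal ?K * indicator (cball 0 R) x"
    proof (cases "\<delta> < x \<bullet> e \<and> norm x < R")
      case True
      then have "x \<bullet> e \<le> R"
        using Basis_le_norm[OF e, of x] by auto
      then have "(x \<bullet> e) powr w \<le> max (\<delta> powr w) (R powr w)"
        using True \<delta> by (cases "0 \<le> w") (auto simp: powr_mono2 powr_mono2' intro: max.coboundedI1 max.coboundedI2)
      also have "\<dots> \<le> \<delta> powr w + R powr w"
        by simp
      finally have "(x \<bullet> e) powr w * \<phi> x \<le> ?K"
        using M(2)[of x] True nonneg by (intro mult_mono') auto
      with True show ?thesis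
        by (auto simp: ennreal_leI)
    next
      case False
      then show ?thesis
        using supp[of x] by (auto simp: indicator_def)
    qed
  qed
  also have "\<dots> = ennreal ?K * emeasure lborel (cball (0::'a) R)"
    by (simp add: nn_integral_cmult_indicator)
  also have "\<dots> < top"
    using emeasure_bounded_finite[of "cball (0::'a) R"] by (simp add: ennreal_mult_less_top)
  finally show ?thesis
    by simp
qed

text \<open>
  Hoelder's inequality: the integrand on the left is the geometric mean of the two on the right, with
  weights \<open>\<alpha>\<close> and \<open>\<beta>\<close>.
\<close>

lemma trunc_integral_interpolation:
  fixes \<phi> :: "'a::euclidean_space \<Rightarrow> real"
  assumes \<phi>: "\<phi> \<in> borel_measurable borel" "\<And>x. 0 \<le> \<phi> x"
    and \<alpha>: "0 < \<alpha>" "0 < \<beta>" "\<alpha> + \<beta> = 1"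
    and w: "w = \<alpha> * w1 + \<beta> * w2" and p: "p = \<alpha> * p1 + \<beta> * p2" and \<delta>: "0 < \<delta>"
  shows "trunc_integral e \<delta> w (\<lambda>x. \<phi> x powr p)
     \<le> enn_powr (trunc_integral e \<delta> w1 (\<lambda>x. \<phi> x powr p1)) \<alpha> *
        enn_powr (trunc_integral e \<delta> w2 (\<lambda>x. \<phi> x powr p2)) \<beta>"
proof -
  have eq: "ennreal (indicator {\<delta><..} (x \<bullet> e) * ((x \<bullet> e) powr w * \<phi> x powr p))
     = enn_powr (ennreal (indicator {\<delta><..} (x \<bullet> e) * ((x \<bullet> e) powr w1 * \<phi> x powr p1))) \<alpha>
     * enn_powr (ennreal (indicator {\<delta><..} (x \<bullet> e) * ((x \<bullet> e) powr w2 * \<phi> x powr p2))) \<beta>" for x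
    using \<delta> by (cases "\<delta> < x \<bullet> e")
      (auto simp: enn_powr_ennreal w p powr_mult powr_powr powr_add ac_simps simp flip: ennreal_mult)
  show ?thesis
    unfolding trunc_integral_def eq by (intro Hoelder_nn_integral_two \<alpha>) (use \<phi> in measurable)
qed

section \<open>The two endpoint inequalities\<close>

text \<open>
  The alternative \<open>bdry\<close> is what the half-line inequalities in direction \<open>e\<close> require: no condition
  at the truncation height for a positive exponent, vanishing there otherwise.
\<close>

locale truncated_C1 =
  fixes e :: "'a::euclidean_space" and G :: "'a \<Rightarrow> real" and G' :: "'a \<Rightarrow> 'a \<Rightarrow> real" and \<delta> a R :: real
  assumes e: "e \<in> Basis"
    and deriv: "\<And>x. (G has_derivative G' x) (at x)"
    and cont': "\<And>b. b \<in> Basis \<Longrightarrow> continuous_on UNIV (\<lambda>x. G' x b)"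
    and nonneg: "\<And>x. 0 \<le> G x"
    and \<delta>: "0 < \<delta>"
    and supp: "\<And>x. R \<le> norm x \<Longrightarrow> G x = 0"
    and bdry: "0 < a \<or> (\<forall>x. x \<bullet> e = \<delta> \<longrightarrow> G x = 0)"
begin

lemma cont: "continuous_on S G"
  using deriv by (meson has_derivative_continuous continuous_at_imp_continuous_on)

lemma meas [measurable]: "G \<in> borel_measurable borel"
  by (intro borel_measurable_continuous_onI cont)

lemma meas': "b \<in> Basis \<Longrightarrow> (\<lambda>x. G' x b) \<in> borel_measurable borel"
  by (intro borel_measurable_continuous_onI cont')

context
  fixes b x :: 'a
  assumes b: "b \<in> Basis"
begin

lemma line_deriv:
  "((\<lambda>s. G (x + (s - x \<bullet> b) *\<^sub>R b)) has_real_derivative G' (x + (s - x \<bullet> b) *\<^sub>R b) b) (at s)"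
proof -
  have "((\<lambda>s. x + (s - x \<bullet> b) *\<^sub>R b) has_derivative (\<lambda>h. h *\<^sub>R b)) (at s)"
    by (auto intro!: derivative_eq_intros)
  from has_derivative_compose[OF this deriv]
  show ?thesis
    by (simp add: has_field_derivative_def linear_scale[OF has_derivative_linear[OF deriv]] mult.commute[of _ "G' _ b"])
qed

lemma line_cont: "continuous_on UNIV (\<lambda>s. G' (x + (s - x \<bullet> b) *\<^sub>R b) b)"
  by (rule continuous_on_compose2[OF cont'[OF b]]) (auto intro!: continuous_intros)

lemma line_supp: "R \<le> \<bar>s\<bar> \<Longrightarrow> G (x + (s - x \<bullet> b) *\<^sub>R b) = 0"
proof -
  assume R: "R \<le> \<bar>s\<bar>"
  have "(x + (s - x \<bullet> b) *\<^sub>R b) \<bullet> b = s"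
    using b by (simp add: inner_add_left)
  then show ?thesis
    using Basis_le_norm[OF b, of "x + (s - x \<bullet> b) *\<^sub>R b"] R by (intro supp) auto
qed

lemma line_inner: "(x + (s - x \<bullet> b) *\<^sub>R b) \<bullet> b = s"
  using b by (simp add: inner_add_left)

lemma line_inner_other: "b \<noteq> e \<Longrightarrow> (x + (s - x \<bullet> b) *\<^sub>R b) \<bullet> e = x \<bullet> e"
  using b e by (simp add: inner_add_left inner_Basis)

end

lemma Hardy: "ennreal \<bar>a\<bar> * trunc_integral e \<delta> (a - 1) G \<le> trunc_integral e \<delta> a (\<lambda>x. \<bar>G' x e\<bar>)"
proof -
  note meas'[OF e, measurable]
  have "ennreal \<bar>a\<bar> * trunc_integral e \<delta> (a - 1) G
    = (\<integral>\<^sup>+x. ennreal \<bar>a\<bar> * ennreal (indicator {\<delta><..} (x \<bullet> e) * ((x \<bullet> e) powr (a - 1) * G x)) \<partial>lborel)"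
    unfolding trunc_integral_def by (intro nn_integral_cmult[symmetric]) measurable
  also have "\<dots> \<le> trunc_integral e \<delta> a (\<lambda>x. \<bar>G' x e\<bar>)"
    unfolding trunc_integral_def
  proof (rule nn_integral_mono_lines[OF e])
    fix x
    show "(\<integral>\<^sup>+s. ennreal \<bar>a\<bar> * ennreal (indicator {\<delta><..} ((x + (s - x \<bullet> e) *\<^sub>R e) \<bullet> e) *
           (((x + (s - x \<bullet> e) *\<^sub>R e) \<bullet> e) powr (a - 1) * G (x + (s - x \<bullet> e) *\<^sub>R e))) \<partial>lborel)
      \<le> (\<integral>\<^sup>+s. ennreal (indicator {\<delta><..} ((x + (s - x \<bullet> e) *\<^sub>R e) \<bullet> e) *
           (((x + (s - x \<bullet> e) *\<^sub>R e) \<bullet> e) powr a * \<bar>G' (x + (s - x \<bullet> e) *\<^sub>R e) e\<bar>)) \<partial>lborel)"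
      unfolding line_inner[OF e]
      using Hardy_halfline[OF line_deriv[OF e, where x=x] line_cont[OF e, where x=x] nonneg \<delta> line_supp[OF e, where x=x], where a=a] bdry
      by (subst nn_integral_cmult) (auto simp: line_inner[OF e])
  qed measurable
  finally show ?thesis .
qed

text \<open>
  The line integrals of \<open>t\<^bsup>w b\<^esup> |\<partial>\<^sub>b G|\<close> dominate \<open>t\<^bsup>w b\<^esup> G\<close>: for \<open>b \<noteq> e\<close> the weight is constant on
  the line, and for \<open>b = e\<close> this is the weighted half-line bound.  With \<open>h = (t\<^bsup>W\<^esup> G)\<^bsup>q\<^esup>\<close> the geometric
  mean of these bounds reads \<open>h\<^bsup>1 - 1/N\<^esup> = t\<^bsup>W\<^esup> G \<le> \<dots>\<close>.  Multiplying it by \<open>h\<^bsup>1/N\<^esup>\<close> produces the left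
  side of the Loomis--Whitney inequality with extra factor \<open>h\<close>, so that the integral of \<open>h\<close> is
  bounded by its own power \<open>1/N\<close> times the product, and that power can be divided out.
\<close>

lemma Sobolev:
  fixes w :: "'a \<Rightarrow> real"
  assumes w: "w e = a" and N: "DIM('a) \<ge> 2"
  defines "N \<equiv> real DIM('a)"
  defines "q \<equiv> N / (N - 1)" and "W \<equiv> (\<Sum>b\<in>Basis. w b) / N"
  shows "enn_powr (trunc_integral e \<delta> (W * q) (\<lambda>x. G x powr q)) (1 - 1 / N)
    \<le> (\<Prod>b\<in>Basis. enn_powr (trunc_integral e \<delta> (w b) (\<lambda>x. \<bar>G' x b\<bar>)) (1 / N))"
proof (rule enn_powr_absorb)
  have N1: "N > 1" "N > 0"
    using N by (auto simp: N_def)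
  have q: "0 < q" "q * (1 - 1 / N) = 1"
    using N1 by (auto simp: q_def field_simps)
  define h where "h x = ennreal (indicator {\<delta><..} (x \<bullet> e) * ((x \<bullet> e) powr (W * q) * G x powr q))" for x
  define F where "F b x = ennreal (indicator {\<delta><..} (x \<bullet> e) * ((x \<bullet> e) powr w b * \<bar>G' x b\<bar>))" for b x
  have hm: "h \<in> borel_measurable borel"
    unfolding h_def by measurable
  have Fm: "F b \<in> borel_measurable borel" if "b \<in> Basis" for b
    using meas'[OF that] unfolding F_def by measurable
  have line: "ennreal ((x \<bullet> e) powr w b * G x) \<le> (\<integral>\<^sup>+s. F b (x + (s - x \<bullet> b) *\<^sub>R b) \<partial>lborel)"
    if b: "b \<in> Basis" and x: "\<delta> < x \<bullet> e" for b x
  proof (cases "b = e")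
    case True
    have "ennreal ((x \<bullet> e) powr a * G (x + (x \<bullet> e - x \<bullet> e) *\<^sub>R e))
      \<le> (\<integral>\<^sup>+s. ennreal (indicator {\<delta><..} s * (s powr a * \<bar>G' (x + (s - x \<bullet> e) *\<^sub>R e) e\<bar>)) \<partial>lborel)"
      using bdry x line_inner[OF e]
      by (intro weighted_sup_le[OF line_deriv[OF e, where x=x] line_cont[OF e, where x=x] nonneg \<delta> line_supp[OF e, where x=x], where a=a]) auto
    then show ?thesis
      using True w by (simp add: F_def line_inner[OF e])
  next
    case False
    have "ennreal (G (x + (x \<bullet> b - x \<bullet> b) *\<^sub>R b)) \<le> (\<integral>\<^sup>+s. ennreal \<bar>G' (x + (s - x \<bullet> b) *\<^sub>R b) b\<bar> \<partial>lborel)"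
      by (rule sup_le_integral_deriv[OF line_deriv[OF b] line_cont[OF b] line_supp[OF b]])
    then have "ennreal ((x \<bullet> e) powr w b) * ennreal (G x)
       \<le> ennreal ((x \<bullet> e) powr w b) * (\<integral>\<^sup>+s. ennreal \<bar>G' (x + (s - x \<bullet> b) *\<^sub>R b) b\<bar> \<partial>lborel)"
      by (intro mult_left_mono) auto
    also have "\<dots> = (\<integral>\<^sup>+s. F b (x + (s - x \<bullet> b) *\<^sub>R b) \<partial>lborel)"
      using x meas'[OF b] by (simp add: F_def line_inner_other[OF b False] ennreal_mult' nn_integral_cmult)
    finally show ?thesis
      by (simp add: ennreal_mult')
  qed
  have "h x \<le> enn_powr (h x) (1 / N) * (\<Prod>b\<in>Basis. enn_powr (\<integral>\<^sup>+s. F b (x + (s - x \<bullet> b) *\<^sub>R b) \<partial>lborel) (1 / N))" for x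
  proof (cases "\<delta> < x \<bullet> e")
    case True
    then have t: "x \<bullet> e > 0"
      using \<delta> by simp
    have "enn_powr (h x) (1 - 1 / N) = ennreal ((x \<bullet> e) powr W * G x)"
      using True q t nonneg[of x] by (simp add: h_def enn_powr_ennreal powr_mult powr_powr mult.assoc)
    also have "\<dots> = ennreal (\<Prod>b\<in>Basis. ((x \<bullet> e) powr w b * G x) powr (1 / N))"
    proof (rule arg_cong[where f = ennreal])
      have "(\<Prod>b\<in>(Basis::'a set). ((x \<bullet> e) powr w b * G x) powr (1 / N))
         = (\<Prod>b\<in>Basis. (x \<bullet> e) powr (w b / N)) * (G x powr (1 / N)) ^ DIM('a)"
        using nonneg[of x] by (simp add: powr_mult powr_powr prod.distrib)
      also have "(\<Prod>b\<in>Basis. (x \<bullet> e) powr (w b / N)) = (x \<bullet> e) powr W"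
        using t by (simp add: W_def powr_sum sum_divide_distrib)
      also have "(G x powr (1 / N)) ^ DIM('a) = G x"
        using nonneg[of x] N1 by (cases "G x = 0") (auto simp: powr_realpow[symmetric] powr_powr N_def)
      finally show "(x \<bullet> e) powr W * G x = (\<Prod>b\<in>Basis. ((x \<bullet> e) powr w b * G x) powr (1 / N))" ..
    qed
    also have "\<dots> = (\<Prod>b\<in>Basis. enn_powr (ennreal ((x \<bullet> e) powr w b * G x)) (1 / N))"
      using nonneg[of x] by (simp add: enn_powr_ennreal prod_ennreal)
    also have "\<dots> \<le> (\<Prod>b\<in>Basis. enn_powr (\<integral>\<^sup>+s. F b (x + (s - x \<bullet> b) *\<^sub>R b) \<partial>lborel) (1 / N))"
      using True N1 by (intro prod_mono_ennreal enn_powr_mono line) auto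
    finally have "enn_powr (h x) (1 / N) * enn_powr (h x) (1 - 1 / N) \<le> enn_powr (h x) (1 / N) * \<dots>"
      by (rule mult_left_mono) simp
    then show ?thesis
      by (simp add: enn_powr_add)
  qed (simp add: h_def)
  then have "(\<integral>\<^sup>+x. h x \<partial>lborel)
    \<le> (\<integral>\<^sup>+x. enn_powr (h x) (1 / N) * (\<Prod>b\<in>Basis. enn_powr (\<integral>\<^sup>+s. F b (x + (s - x \<bullet> b) *\<^sub>R b) \<partial>lborel) (1 / N)) \<partial>lborel)"
    by (intro nn_integral_mono)
  also have "\<dots> \<le> enn_powr (\<integral>\<^sup>+x. h x \<partial>lborel) (1 / N) * (\<Prod>b\<in>Basis. enn_powr (\<integral>\<^sup>+x. F b x \<partial>lborel) (1 / N))"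
    unfolding N_def by (intro loomis_whitney_lborel Fm hm)
  finally show "trunc_integral e \<delta> (W * q) (\<lambda>x. G x powr q)
     \<le> enn_powr (trunc_integral e \<delta> (W * q) (\<lambda>x. G x powr q)) (1 / N) *
       (\<Prod>b\<in>Basis. enn_powr (trunc_integral e \<delta> (w b) (\<lambda>x. \<bar>G' x b\<bar>)) (1 / N))"
    unfolding trunc_integral_def h_def F_def .
  show "trunc_integral e \<delta> (W * q) (\<lambda>x. G x powr q) \<noteq> top"
  proof (rule trunc_integral_finite[OF _ _ _ e \<delta>])
    show "continuous_on UNIV (\<lambda>x. G x powr q)"
      using q nonneg by (intro continuous_on_powr' cont continuous_intros) auto
    show "0 \<le> G x powr q" for x
      by simp
    show "R \<le> norm x \<Longrightarrow> G x powr q = 0" for x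
      using supp by simp
  qed
  show "1 / N < 1"
    using N1 by simp
qed

end

section \<open>The inequality away from the boundary\<close>

lemma has_real_derivative_abs_powr:
  fixes s r :: real
  assumes "1 < s"
  shows "((\<lambda>r. \<bar>r\<bar> powr s) has_real_derivative s * (\<bar>r\<bar> powr (s - 1) * sgn r)) (at r)"
proof (cases r "0::real" rule: linorder_cases)
  case greater
  have "((\<lambda>r. r powr s) has_real_derivative s * (\<bar>r\<bar> powr (s - 1) * sgn r)) (at r)"
    using greater by (auto intro!: derivative_eq_intros)
  then show ?thesis
    by (rule has_field_derivative_transform_within_open[where S = "{0<..}"]) (use greater in auto)
next
  case less
  have "((\<lambda>r. (-r) powr s) has_real_derivative s * (\<bar>r\<bar> powr (s - 1) * sgn r)) (at r)"
    using less by (auto intro!: derivative_eq_intros)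
  then show ?thesis
    by (rule has_field_derivative_transform_within_open[where S = "{..<0}"]) (use less in auto)
next
  case equal
  have "((\<lambda>h. \<bar>h\<bar> powr (s - 1)) \<longlongrightarrow> \<bar>0::real\<bar> powr (s - 1)) (at (0::real))"
    using assms by (intro tendsto_powr' tendsto_intros) auto
  then have "((\<lambda>h. \<bar>h\<bar> powr (s - 1)) \<longlongrightarrow> 0) (at (0::real))"
    by simp
  moreover have "norm (\<bar>h\<bar> powr s / h) = \<bar>h\<bar> powr (s - 1)" for h :: real
    by (auto simp: powr_diff)
  ultimately have "((\<lambda>h::real. norm (\<bar>h\<bar> powr s / h)) \<longlongrightarrow> 0) (at 0)"
    by simp
  then have "((\<lambda>h::real. \<bar>h\<bar> powr s / h) \<longlongrightarrow> 0) (at 0)"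
    by (rule tendsto_norm_zero_cancel)
  then show ?thesis
    using equal by (simp add: DERIV_def)
qed

lemma continuous_on_abs_powr_sgn:
  fixes p :: real
  assumes "0 < p"
  shows "continuous_on UNIV (\<lambda>r::real. \<bar>r\<bar> powr p * sgn r)"
proof -
  have "(\<lambda>r::real. \<bar>r\<bar> powr p * sgn r) = (\<lambda>r. max r 0 powr p - max (- r) 0 powr p)"
    by (auto simp: fun_eq_iff sgn_if max_def)
  moreover have "continuous_on UNIV (\<lambda>r::real. max r 0 powr p - max (- r) 0 powr p)"
    using assms by (intro continuous_on_diff continuous_on_powr' continuous_intros) auto
  ultimately show ?thesis
    by (simp only:)
qed

text \<open>
  The weight \<open>t\<^bsup>v b\<^esup>\<close> of the partial derivative in direction \<open>b\<close> is arbitrary, except in the direction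
  \<open>e\<close> itself; the sum \<open>D\<close> replaces \<open>N + \<gamma> p\<close>.  In the constant, \<open>s\<close> comes from the chain rule for
  \<open>|f|\<^bsup>s\<^esup>\<close> and \<open>|a|\<^bsup>-\<alpha>\<^esup>\<close> from Hardy's inequality.  Neither \<open>\<delta>\<close> nor the support of \<open>f\<close> enters it,
  which is what makes the limit \<open>\<delta> \<rightarrow> 0\<close> possible.
\<close>

lemma caffarelli_kohn_nirenberg_truncated:
  fixes f :: "'a::euclidean_space \<Rightarrow> real" and f' :: "'a \<Rightarrow> 'a \<Rightarrow> real" and v :: "'a \<Rightarrow> real"
    and A B Q \<delta> R :: real
  defines "N \<equiv> real DIM('a)" and "D \<equiv> real DIM('a) + (\<Sum>b\<in>Basis. v b)"
  defines "a \<equiv> B * Q / 2 + A" and "s \<equiv> Q / 2 + 1"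
  defines "\<Phi> \<equiv> (\<lambda>x e. \<Sum>b\<in>Basis. ((x \<bullet> e) powr v b * f' x b)\<^sup>2)"
  defines "\<alpha> \<equiv> 1 - (Q - 2) * (N - 1) / (Q + 2)"
  assumes e: "e \<in> Basis" and v: "v e = 0"
    and N: "DIM('a) \<ge> 2" and Q: "2 \<le> Q" "Q * (N - 2) \<le> 2 * N"
    and B: "B = A - 1 + (Q - 2) / (2 * Q) * D" and a: "a \<noteq> 0"
    and deriv: "\<And>x. (f has_derivative f' x) (at x)"
    and cont': "\<And>b. b \<in> Basis \<Longrightarrow> continuous_on UNIV (\<lambda>x. f' x b)"
    and supp: "\<And>x. R \<le> norm x \<Longrightarrow> f x = 0"
    and \<delta>: "0 < \<delta>" and bdry: "0 < a \<or> (\<forall>x. x \<bullet> e = \<delta> \<longrightarrow> f x = 0)"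
  shows "enn_powr (trunc_integral e \<delta> (B * Q) (\<lambda>x. \<bar>f x\<bar> powr Q)) (2 / Q)
     \<le> ennreal ((\<bar>a\<bar> powr (- \<alpha>)) powr ((Q + 2) / Q) * s\<^sup>2) * trunc_integral e \<delta> (2 * A) (\<lambda>x. \<Phi> x e)"
proof -
  have Qpos: "Q > 0" "Q + 2 > 0" using Q by auto
  have N2: "N \<ge> 2" using N by (simp add: N_def)
  have s: "s > 1" "s > 0" using Q by (auto simp: s_def)
  \<comment> \<open>The exponent of \<open>G\<close>: since \<open>s q = Q\<close>, the power \<open>G\<^bsup>q\<^esup>\<close> is \<open>|f|\<^bsup>Q\<^esup>\<close>.\<close>
  define q where "q = 2 * Q / (Q + 2)"
  define \<beta> where "\<beta> = (Q - 2) * (N - 1) / (Q + 2)"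
  \<comment> \<open>The Sobolev exponent of the \<open>L\<^sup>1\<close> inequality; \<open>q\<close> lies between \<open>1\<close> and \<open>qs\<close>.\<close>
  define qs where "qs = N / (N - 1)"
  have contf: "continuous_on S f" for S
    using deriv by (meson has_derivative_continuous continuous_at_imp_continuous_on)
  have fm [measurable]: "f \<in> borel_measurable borel"
    by (intro borel_measurable_continuous_onI contf)
  have f'm: "(\<lambda>x. f' x b) \<in> borel_measurable borel" if "b \<in> Basis" for b
    by (intro borel_measurable_continuous_onI cont' that)
  have \<Phi>m [measurable]: "(\<lambda>x. \<Phi> x e) \<in> borel_measurable borel"
    unfolding \<Phi>_def using f'm by measurable
  define G where "G x = \<bar>f x\<bar> powr s" for x
  define G' where "G' x h = s * (\<bar>f x\<bar> powr (s - 1) * sgn (f x)) * f' x h" for x h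
  interpret G: truncated_C1 e G G' \<delta> a R
  proof
    show "(G has_derivative G' x) (at x)" for x
    proof -
      have "((\<lambda>r. \<bar>r\<bar> powr s) has_derivative (\<lambda>h. s * (\<bar>f x\<bar> powr (s - 1) * sgn (f x)) * h)) (at (f x))"
        using has_real_derivative_abs_powr[OF s(1), of "f x"] by (simp add: has_field_derivative_def)
      from has_derivative_compose[OF deriv this]
      show ?thesis
        by (simp add: G_def[abs_def] G'_def[abs_def])
    qed
    show "continuous_on UNIV (\<lambda>x. G' x b)" if "b \<in> Basis" for b
      unfolding G'_def using s
      by (intro continuous_intros cont' that continuous_on_compose2[OF continuous_on_abs_powr_sgn contf]) auto
    show "0 < a \<or> (\<forall>x. x \<bullet> e = \<delta> \<longrightarrow> G x = 0)"
      using bdry by (auto simp: G_def)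
  qed (use e \<delta> supp in \<open>auto simp: G_def\<close>)
  define X where "X = trunc_integral e \<delta> (B * Q) (\<lambda>x. \<bar>f x\<bar> powr Q)"
  define W where "W = trunc_integral e \<delta> (2 * A) (\<lambda>x. \<Phi> x e)"
  define Z where "Z = ennreal s * (enn_powr X (1 / 2) * enn_powr W (1 / 2))"
  \<comment> \<open>Cauchy--Schwarz, because \<open>t\<^bsup>a + v b\<^esup> |\<partial>\<^sub>b G| = s (t\<^bsup>BQ/2\<^esup> |f|\<^bsup>Q/2\<^esup>) (t\<^bsup>A + v b\<^esup> |\<partial>\<^sub>b f|)\<close>.\<close>
  have E: "trunc_integral e \<delta> (a + v b) (\<lambda>x. \<bar>G' x b\<bar>) \<le> Z" if b: "b \<in> Basis" for b
  proof -
    let ?hX = "\<lambda>x. ennreal (indicator {\<delta><..} (x \<bullet> e) * ((x \<bullet> e) powr (B * Q) * \<bar>f x\<bar> powr Q))"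
    let ?hW = "\<lambda>x. ennreal (indicator {\<delta><..} (x \<bullet> e) * ((x \<bullet> e) powr (2 * A) * \<Phi> x e))"
    have pt: "ennreal (indicator {\<delta><..} (x \<bullet> e) * ((x \<bullet> e) powr (a + v b) * \<bar>G' x b\<bar>))
       \<le> ennreal s * (enn_powr (?hX x) (1 / 2) * enn_powr (?hW x) (1 / 2))" for x
    proof (cases "\<delta> < x \<bullet> e")
      case True
      then have t: "0 < x \<bullet> e" using \<delta> by simp
      have \<Phi>0: "0 \<le> \<Phi> x e"
        unfolding \<Phi>_def by (intro sum_nonneg) auto
      have "((x \<bullet> e) powr v b * f' x b)\<^sup>2 \<le> \<Phi> x e"
        unfolding \<Phi>_def using b by (intro member_le_sum) auto
      then have "\<bar>(x \<bullet> e) powr v b * f' x b\<bar> \<le> sqrt (\<Phi> x e)"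
        by (rule real_le_rsqrt[of "\<bar>_\<bar>", simplified])
      then have 1: "(x \<bullet> e) powr v b * \<bar>f' x b\<bar> \<le> \<Phi> x e powr (1 / 2)"
        using \<Phi>0 by (simp add: abs_mult powr_half_sqrt)
      have 2: "\<bar>G' x b\<bar> \<le> s * (\<bar>f x\<bar> powr (Q / 2) * \<bar>f' x b\<bar>)"
        using s by (auto simp: G'_def abs_mult sgn_if s_def)
      have "(x \<bullet> e) powr (a + v b) * \<bar>G' x b\<bar>
          \<le> (x \<bullet> e) powr (a + v b) * (s * (\<bar>f x\<bar> powr (Q / 2) * \<bar>f' x b\<bar>))"
        by (intro mult_left_mono 2) auto
      also have "\<dots> = s * ((x \<bullet> e) powr (B * Q / 2) * \<bar>f x\<bar> powr (Q / 2) *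
           ((x \<bullet> e) powr A * ((x \<bullet> e) powr v b * \<bar>f' x b\<bar>)))"
        by (simp add: a_def powr_add)
      also have "\<dots> \<le> s * ((x \<bullet> e) powr (B * Q / 2) * \<bar>f x\<bar> powr (Q / 2) *
           ((x \<bullet> e) powr A * \<Phi> x e powr (1 / 2)))"
        using s by (intro mult_left_mono 1) auto
      finally show ?thesis
        using True \<Phi>0 s
        by (simp add: enn_powr_ennreal powr_mult powr_powr ennreal_leI flip: ennreal_mult)
    qed simp
    have hm: "?hX \<in> borel_measurable lborel" "?hW \<in> borel_measurable lborel"
      by measurable
    have "trunc_integral e \<delta> (a + v b) (\<lambda>x. \<bar>G' x b\<bar>)
      \<le> (\<integral>\<^sup>+x. ennreal s * (enn_powr (?hX x) (1 / 2) * enn_powr (?hW x) (1 / 2)) \<partial>lborel)"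
      unfolding trunc_integral_def by (intro nn_integral_mono pt)
    also have "\<dots> = ennreal s * (\<integral>\<^sup>+x. enn_powr (?hX x) (1 / 2) * enn_powr (?hW x) (1 / 2) \<partial>lborel)"
      by (intro nn_integral_cmult) measurable
    also have "\<dots> \<le> Z"
      unfolding Z_def X_def W_def trunc_integral_def
      by (intro mult_left_mono Hoelder_nn_integral_two hm) auto
    finally show ?thesis .
  qed
  define Y where "Y = trunc_integral e \<delta> (a - 1) G"
  define w where "w b = a + v b" for b
  define XS where "XS = trunc_integral e \<delta> ((\<Sum>b\<in>Basis. w b) / N * qs) (\<lambda>x. G x powr qs)"
  have sumw: "(\<Sum>b\<in>Basis. w b) = N * a + (D - N)"
    by (simp add: w_def sum.distrib D_def N_def)
  have Y: "Y \<le> ennreal (1 / \<bar>a\<bar>) * Z"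
  proof -
    have "Y = ennreal (1 / \<bar>a\<bar>) * (ennreal \<bar>a\<bar> * Y)"
      using a by (simp add: mult.assoc[symmetric] flip: ennreal_mult)
    also have "\<dots> \<le> ennreal (1 / \<bar>a\<bar>) * Z"
      using order_trans[OF G.Hardy] E[OF e] v by (intro mult_left_mono) (auto simp: Y_def)
    finally show ?thesis .
  qed
  have "enn_powr XS (1 - 1 / N) \<le> (\<Prod>b\<in>Basis. enn_powr (trunc_integral e \<delta> (w b) (\<lambda>x. \<bar>G' x b\<bar>)) (1 / N))"
    unfolding XS_def N_def qs_def using v N by (intro G.Sobolev) (auto simp: w_def)
  also have "\<dots> \<le> (\<Prod>b\<in>(Basis::'a set). enn_powr Z (1 / N))"
    using N2 E by (intro prod_mono_ennreal enn_powr_mono) (auto simp: w_def)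
  also have "\<dots> = Z"
  proof -
    have "enn_powr (\<Prod>b\<in>(Basis::'a set). Z) (1 / N) = Z"
    proof (cases Z)
      case (real r)
      have "(r ^ DIM('a)) powr (1 / N) = r"
        using real(1) N2 by (cases "r = 0") (auto simp: powr_powr N_def simp flip: powr_realpow)
      then show ?thesis
        using real by (simp add: ennreal_power enn_powr_ennreal)
    qed (simp add: top_power_ennreal)
    then show ?thesis
      by (simp only: enn_powr_prod)
  qed
  finally have "enn_powr (enn_powr XS (1 - 1 / N)) qs \<le> enn_powr Z qs"
    using N2 by (intro enn_powr_mono) (auto simp: qs_def)
  moreover have "(1 - 1 / N) * qs = 1"
    using N2 by (simp add: qs_def field_simps)
  ultimately have XS: "XS \<le> enn_powr Z qs"
    by (simp add: enn_powr_powr)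
  have \<alpha>\<beta>: "\<alpha> + \<beta> = 1" "0 \<le> \<beta>" "0 \<le> \<alpha>"
  proof -
    show "\<alpha> + \<beta> = 1" by (simp add: \<alpha>_def \<beta>_def)
    show "0 \<le> \<beta>" using Q N2 by (simp add: \<beta>_def)
    have "(Q - 2) * (N - 1) \<le> Q + 2" using Q by (simp add: algebra_simps)
    then show "0 \<le> \<alpha>" using Qpos by (simp add: \<alpha>_def)
  qed
  have q1: "q - 1 = (Q - 2) / (Q + 2)"
    using Qpos by (simp add: q_def field_simps)
  then have \<beta>q1: "\<beta> = (q - 1) * (N - 1)"
    by (simp add: \<beta>_def)
  have \<beta>q: "\<beta> * qs = (q - 1) * N" "\<alpha> + \<beta> * qs = q"
  proof -
    show "\<beta> * qs = (q - 1) * N"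
      using N2 by (simp add: \<beta>q1 qs_def)
    moreover have "\<alpha> = 1 - (q - 1) * (N - 1)"
      using \<alpha>\<beta>(1) \<beta>q1 by simp
    ultimately show "\<alpha> + \<beta> * qs = q"
      by (simp add: algebra_simps)
  qed
  have expf: "s * (\<alpha> + \<beta> * qs) = Q"
    unfolding \<beta>q(2) using Qpos by (simp add: s_def q_def field_simps)
  \<comment> \<open>The scaling condition on \<open>B\<close> makes the exponents of \<open>t\<close> match.\<close>
  have expw: "B * Q = \<alpha> * (a - 1) + \<beta> * ((\<Sum>b\<in>Basis. w b) / N * qs)"
  proof -
    have e1: "\<beta> * ((\<Sum>b\<in>Basis. w b) / N * qs) = (q - 1) * (N * a + (D - N))"
    proof -
      have "\<beta> * ((\<Sum>b\<in>Basis. w b) / N * qs) = (\<beta> * qs) * ((\<Sum>b\<in>Basis. w b) / N)"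
        by simp
      also have "\<dots> = (q - 1) * (N * a + (D - N))"
        unfolding \<beta>q(1) sumw using N2 by simp
      finally show ?thesis .
    qed
    have e2: "\<alpha> = q - (q - 1) * N"
      using \<beta>q(2) unfolding \<beta>q(1) by simp
    have "\<alpha> * (a - 1) + \<beta> * ((\<Sum>b\<in>Basis. w b) / N * qs) = q * (a - 1) + (q - 1) * D"
      unfolding e1 e2 by (simp add: algebra_simps)
    also have "\<dots> = (2 * Q * (a - 1) + (Q - 2) * D) / (Q + 2)"
      unfolding q1 by (simp add: q_def add_divide_distrib)
    also have "2 * Q * (a - 1) + (Q - 2) * D = B * Q * (Q + 2)"
      using Qpos by (simp add: a_def B field_simps)
    finally show ?thesis
      using Qpos by simp
  qed
  have "X \<le> ennreal (\<bar>a\<bar> powr (- \<alpha>)) * enn_powr Z q"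
  proof -
    consider "\<alpha> = 0" "\<beta> = 1" | "\<beta> = 0" "\<alpha> = 1" | "0 < \<alpha>" "0 < \<beta>"
      using \<alpha>\<beta> by fastforce
    then show ?thesis
    proof cases
      case 1
      then have "X = XS"
        using expw expf by (simp add: X_def XS_def G_def powr_powr)
      then show ?thesis
        using XS a \<beta>q 1 by simp
    next
      case 2
      then have "X = Y"
        using expw expf by (simp add: X_def Y_def G_def[abs_def])
      moreover have "q = 1"
        using \<beta>q 2 by simp
      ultimately show ?thesis
        using Y a 2 by (simp add: powr_minus divide_inverse)
    next
      case 3
      have "X \<le> enn_powr (trunc_integral e \<delta> (a - 1) (\<lambda>x. \<bar>f x\<bar> powr s)) \<alpha> *
        enn_powr (trunc_integral e \<delta> ((\<Sum>b\<in>Basis. w b) / N * qs) (\<lambda>x. \<bar>f x\<bar> powr (s * qs))) \<beta>"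
        unfolding X_def
        by (rule trunc_integral_interpolation[OF _ _ 3 \<alpha>\<beta>(1) expw _ \<delta>]) (use expf in \<open>auto simp: algebra_simps\<close>)
      also have "\<dots> = enn_powr Y \<alpha> * enn_powr XS \<beta>"
        by (simp add: Y_def XS_def G_def[abs_def] powr_powr)
      also have "\<dots> \<le> enn_powr (ennreal (1 / \<bar>a\<bar>) * Z) \<alpha> * enn_powr (enn_powr Z qs) \<beta>"
        using Y XS \<alpha>\<beta> by (intro mult_mono enn_powr_mono) auto
      also have "\<dots> = ennreal (\<bar>a\<bar> powr (- \<alpha>)) * enn_powr Z q"
        using \<beta>q a
        by (simp add: enn_powr_mult enn_powr_powr mult.assoc enn_powr_add mult.commute[of qs] enn_powr_ennreal
             powr_minus powr_divide inverse_eq_divide)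
      finally show ?thesis .
    qed
  qed
  also have "enn_powr Z q = enn_powr X (q / 2) * (ennreal (s powr q) * enn_powr W (q / 2))"
    using s by (simp add: Z_def enn_powr_mult enn_powr_powr enn_powr_ennreal ac_simps)
  finally have "X \<le> enn_powr X (q / 2) * (ennreal (\<bar>a\<bar> powr (- \<alpha>)) * (ennreal (s powr q) * enn_powr W (q / 2)))"
    by (simp add: ac_simps)
  moreover have "X \<noteq> top"
    unfolding X_def
  proof (rule trunc_integral_finite[OF _ _ _ e \<delta>])
    show "continuous_on UNIV (\<lambda>x. \<bar>f x\<bar> powr Q)"
      using Q by (intro continuous_on_powr' continuous_intros contf) auto
  qed (use supp in auto)
  moreover have "q / 2 < 1"
    using Qpos by (simp add: q_def)
  ultimately have "enn_powr X (1 - q / 2) \<le> ennreal (\<bar>a\<bar> powr (- \<alpha>)) * (ennreal (s powr q) * enn_powr W (q / 2))"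
    by (rule enn_powr_absorb)
  then have le: "enn_powr (enn_powr X (1 - q / 2)) ((Q + 2) / Q)
     \<le> enn_powr (ennreal (\<bar>a\<bar> powr (- \<alpha>)) * (ennreal (s powr q) * enn_powr W (q / 2))) ((Q + 2) / Q)"
    using Qpos by (intro enn_powr_mono) auto
  have ex: "q * ((Q + 2) / Q) = 2" "q / 2 * ((Q + 2) / Q) = 1"
    using Qpos by (auto simp: q_def)
  then have ex': "(1 - q / 2) * ((Q + 2) / Q) = 2 / Q"
    using Qpos unfolding left_diff_distrib by (simp add: add_divide_distrib)
  have "enn_powr (ennreal (s powr q)) ((Q + 2) / Q) = ennreal (s\<^sup>2)"
    using s unfolding enn_powr_ennreal[OF powr_ge_zero] powr_powr ex by simp
  with le show ?thesis
    unfolding X_def[symmetric] W_def[symmetric] enn_powr_mult enn_powr_powr ex ex' enn_powr_one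
    by (simp add: enn_powr_ennreal ennreal_mult mult.assoc)
qed

section \<open>Passing to the half space\<close>

lemma trunc_integral_antimono:
  assumes "\<delta> \<le> \<delta>'" "\<And>x. 0 \<le> \<phi> x"
  shows "trunc_integral e \<delta>' w \<phi> \<le> trunc_integral e \<delta> w \<phi>"
  unfolding trunc_integral_def using assms
  by (intro nn_integral_mono) (auto simp: indicator_def)

lemma trunc_integral_zero_le:
  fixes \<phi> :: "'a::euclidean_space \<Rightarrow> real"
  assumes \<phi>: "\<phi> \<in> borel_measurable borel" "\<And>x. 0 \<le> \<phi> x"
    and bound: "\<And>n. trunc_integral e (1 / real (Suc n)) w \<phi> \<le> K"
  shows "trunc_integral e 0 w \<phi> \<le> K"
proof -
  define F where "F n x = ennreal (indicator {1 / real (Suc n)<..} (x \<bullet> e) * ((x \<bullet> e) powr w * \<phi> x))" for n x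
  have "trunc_integral e 0 w \<phi> \<le> (\<integral>\<^sup>+x. (SUP n. F n x) \<partial>lborel)"
    unfolding trunc_integral_def
  proof (intro nn_integral_mono)
    fix x :: 'a
    show "ennreal (indicator {0<..} (x \<bullet> e) * ((x \<bullet> e) powr w * \<phi> x)) \<le> (SUP n. F n x)"
    proof (cases "0 < x \<bullet> e")
      case True
      then obtain n where "1 / real (Suc n) < x \<bullet> e"
        using nat_approx_posE by blast
      then have "ennreal (indicator {0<..} (x \<bullet> e) * ((x \<bullet> e) powr w * \<phi> x)) \<le> F n x"
        using True by (simp add: F_def)
      then show ?thesis
        by (meson SUP_upper2 UNIV_I)
    qed simp
  qed
  also have "\<dots> = (SUP n. \<integral>\<^sup>+x. F n x \<partial>lborel)"
  proof (rule nn_integral_monotone_convergence_SUP)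
    have "F m x \<le> F n x" if "m \<le> n" for m n x
    proof -
      have "1 / real (Suc n) \<le> 1 / real (Suc m)"
        using that by (simp add: frac_le)
      then show ?thesis
        using \<phi>(2)[of x] by (auto simp: F_def indicator_def)
    qed
    then show "incseq F"
      by (auto simp: incseq_def le_fun_def)
    show "F n \<in> borel_measurable lborel" for n
      unfolding F_def using \<phi>(1) by measurable
  qed
  also have "\<dots> \<le> K"
    using bound unfolding F_def trunc_integral_def by (intro SUP_least)
  finally show ?thesis .
qed

lemma norm_grad_squared:
  fixes g :: "'a::euclidean_space \<Rightarrow> real"
  assumes "(g has_derivative g') (at x)"
  shows "(norm (grad g x))\<^sup>2 = (\<Sum>b\<in>Basis. (g' b)\<^sup>2)"
proof -
  let ?D = "\<Sum>b\<in>Basis. g' b *\<^sub>R b"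
  have "g' = (\<lambda>h. h \<bullet> ?D)"
  proof
    fix h
    have "g' h = g' (\<Sum>b\<in>Basis. (h \<bullet> b) *\<^sub>R b)"
      by (simp add: euclidean_representation)
    also have "\<dots> = (\<Sum>b\<in>Basis. (h \<bullet> b) * g' b)"
      using has_derivative_linear[OF assms] by (simp add: linear_sum linear_scale)
    finally show "g' h = h \<bullet> ?D"
      by (simp add: inner_sum_right mult.commute)
  qed
  then have "GDERIV g x :> ?D"
    using assms by (simp add: gderiv_def)
  then have "grad g x = ?D"
    by (rule grad_eqI)
  then have "(norm (grad g x))\<^sup>2 = (\<Sum>b\<in>Basis. (?D \<bullet> b) * (?D \<bullet> b))"
    by (simp only: power2_norm_eq_inner euclidean_inner[of ?D ?D])
  also have "\<dots> = (\<Sum>b\<in>Basis. (g' b)\<^sup>2)"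
    by (intro sum.cong refl) (simp add: inner_sum_left_Basis power2_eq_square)
  finally show ?thesis .
qed

lemma sum_Basis_prod:
  "(\<Sum>b\<in>(Basis :: ('a::euclidean_space \<times> 'b::euclidean_space) set). g b)
    = (\<Sum>u\<in>Basis. g (u, 0)) + (\<Sum>v\<in>Basis. g (0, v))"
proof -
  have "inj_on (\<lambda>u. (u::'a, 0::'b)) Basis" "inj_on (\<lambda>v. (0::'a, v::'b)) Basis"
    by (auto intro!: inj_onI)
  moreover have "(\<lambda>u::'a. (u, 0::'b)) ` Basis \<inter> (\<lambda>v. (0, v)) ` Basis = {}"
    using nonzero_Basis by fastforce
  ultimately show ?thesis
    unfolding Basis_prod_def by (subst sum.union_disjoint) (auto simp: sum.reindex)
qed

lemma test_functionsD:
  assumes "f \<in> test_functions U"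
  shows "(f has_derivative frechet_derivative f (at x)) (at x)"
    and "b \<in> Basis \<Longrightarrow> continuous_on UNIV (\<lambda>x. frechet_derivative f (at x) b)"
    and "\<exists>R. \<forall>x. R \<le> norm x \<longrightarrow> f x = 0"
proof -
  have "C_k (Suc 0) f"
    using assms unfolding test_functions_def smooth_def by blast
  then have "f differentiable_on UNIV" "\<forall>b\<in>Basis. continuous_on UNIV (\<lambda>x. frechet_derivative f (at x) b)"
    by simp_all
  then show "(f has_derivative frechet_derivative f (at x)) (at x)"
    "b \<in> Basis \<Longrightarrow> continuous_on UNIV (\<lambda>x. frechet_derivative f (at x) b)"
    by (simp_all add: differentiable_on_def frechet_derivative_works)
  have "bounded {x. f x \<noteq> 0}"
    using assms by (auto simp: test_functions_def intro: bounded_subset[OF compact_imp_bounded closure_subset])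
  then obtain r where "\<forall>x\<in>{x. f x \<noteq> 0}. norm x \<le> r"
    by (auto simp: bounded_iff)
  then show "\<exists>R. \<forall>x. R \<le> norm x \<longrightarrow> f x = 0"
    by (intro exI[of _ "r + 1"]) force
qed

definition vert :: "('m::finite, 'p::finite) point" where
  "vert = (0, 1, 0)"

lemma vert_Basis: "vert \<in> Basis"
  by (auto simp: vert_def Basis_prod_def)

lemma height_eq_inner: "height x = x \<bullet> vert"
  by (cases x) (simp add: vert_def inner_prod_def)

text \<open>
  The exponent \<open>v\<close> for which the truncated inequality has the weights of the theorem: it is \<open>\<gamma>\<close> on the
  basis vectors in the \<open>y\<close>-directions and \<open>0\<close> on all others.
\<close>

definition y_weight :: "real \<Rightarrow> ('m::finite, 'p::finite) point \<Rightarrow> real" where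
  "y_weight \<gamma> b = (if snd (snd b) = 0 then 0 else \<gamma>)"

lemma sum_Basis_point:
  "(\<Sum>b\<in>(Basis :: ('m::finite, 'p::finite) point set). g b)
    = (\<Sum>u\<in>Basis. g (u, 0, 0)) + (g (0, 1, 0) + (\<Sum>w\<in>Basis. g (0, 0, w)))"
  by (simp add: sum_Basis_prod zero_prod_def)

lemma sum_y_weight:
  "(\<Sum>b\<in>(Basis :: ('m::finite, 'p::finite) point set). y_weight \<gamma> b) = \<gamma> * real CARD('p)"
  by (simp add: sum_Basis_point y_weight_def nonzero_Basis)

lemma energy_density_eq:
  fixes f :: "('m::finite, 'p::finite) point \<Rightarrow> real"
  assumes f: "(f has_derivative f') (at x)" and t: "0 < height x"
  shows "(norm (grad_x f x))\<^sup>2 + height x powr (2 * \<gamma>) * (norm (grad_y f x))\<^sup>2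
     = (\<Sum>b\<in>Basis. (height x powr y_weight \<gamma> b * f' b)\<^sup>2)"
proof -
  obtain x' t y where x: "x = (x', t, y)"
    by (cases x)
  have "((\<lambda>z. (fst z, snd z, y)) has_derivative (\<lambda>h. (fst h, snd h, 0))) (at (x', t))"
    by (auto intro!: derivative_eq_intros)
  from has_derivative_compose[OF this, of f f'] f
  have "((\<lambda>(u, s). f (u, s, y)) has_derivative (\<lambda>h. f' (fst h, snd h, 0))) (at (x', t))"
    by (simp add: x case_prod_beta')
  then have gx: "(norm (grad_x f x))\<^sup>2 = (\<Sum>b\<in>Basis. (f' (fst b, snd b, 0))\<^sup>2)"
    unfolding x grad_x.simps by (rule norm_grad_squared)
  have "((\<lambda>v. (x', t, v)) has_derivative (\<lambda>h. (0, 0, h))) (at y)"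
    by (auto intro!: derivative_eq_intros)
  from has_derivative_compose[OF this, of f f'] f
  have "((\<lambda>v. f (x', t, v)) has_derivative (\<lambda>h. f' (0, 0, h))) (at y)"
    by (simp add: x)
  then have gy: "(norm (grad_y f x))\<^sup>2 = (\<Sum>b\<in>Basis. (f' (0, 0, b))\<^sup>2)"
    unfolding x grad_y.simps by (rule norm_grad_squared)
  have "(height x powr \<gamma> * z)\<^sup>2 = height x powr (2 * \<gamma>) * z\<^sup>2" for z
    using t by (simp add: power_mult_distrib powr_power)
  then show ?thesis
    using t unfolding gx gy sum_Basis_point
    by (simp add: sum_Basis_prod y_weight_def nonzero_Basis sum_distrib_left)
qed

lemma test_functions_away_from_boundary:
  fixes f :: "('m::finite, 'p::finite) point \<Rightarrow> real"
  assumes "f \<in> test_functions half_space"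
  obtains d where "0 < d" "\<And>x. height x < d \<Longrightarrow> f x = 0"
proof -
  let ?S = "closure {x. f x \<noteq> 0}"
  have S: "compact ?S" "?S \<subseteq> half_space"
    using assms by (auto simp: test_functions_def)
  have sub: "f x \<noteq> 0 \<Longrightarrow> x \<in> ?S" for x
    by (rule subsetD[OF closure_subset]) simp
  show ?thesis
  proof (cases "?S = {}")
    case True
    show ?thesis
    proof (rule that[of 1])
      show "f x = 0" for x
        using sub[of x] unfolding True by blast
    qed simp
  next
    case False
    have "continuous_on ?S (\<lambda>x. height x)"
      unfolding height_eq_inner by (intro continuous_intros)
    from continuous_attains_inf[OF S(1) False this]
    obtain z where z: "z \<in> ?S" "\<forall>x\<in>?S. height z \<le> height x"
      by (elim bexE)
    show ?thesis
    proof (rule that[of "height z"])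
      show "0 < height z"
        using subsetD[OF S(2) z(1)] by (simp add: half_space_def)
      show "f x = 0" if "height x < height z" for x
        using that z(2) sub[of x] by (meson not_le)
    qed
  qed
qed

theorem theorem1p7:
  fixes N k :: nat and \<gamma> A B Q :: real
  assumes "1 < k" "k < N"
    and "CARD('m::finite) = N - k" "CARD('p::finite) = k - 1"
    and "(N = 2 \<and> Q \<ge> 2 \<and>
            B = A - 1 + (Q - 2) / (2 * Q) * (2 + \<gamma> * (real k - 1))) \<or>
         (N \<ge> 3 \<and> 2 \<le> Q \<and> Q \<le> 2 * real N / (real N - 2) \<and>
            B = A - 1 + (Q - 2) / (2 * Q) * (real N + \<gamma> * (real k - 1)))"
    and "B * Q + 2 * A \<noteq> 0"
  shows "\<exists>C>0.
    (\<forall>f \<in> test_functions (half_space :: ('m, 'p) point set). weighted_ineq C A B Q \<gamma> f) \<and>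
    (B * Q + 2 * A > 0 \<longrightarrow>
      (\<forall>f \<in> test_functions (UNIV :: ('m, 'p) point set). weighted_ineq C A B Q \<gamma> f))"
proof -
  let ?e = "vert :: ('m, 'p) point"
  have N: "N \<ge> 3" "real DIM(('m, 'p) point) = real N"
    using assms(1-4) by auto
  have Q: "2 \<le> Q" "Q \<le> 2 * real N / (real N - 2)"
    and B: "B = A - 1 + (Q - 2) / (2 * Q) * (real N + \<gamma> * (real k - 1))"
    using assms(5) N(1) by auto
  have QN: "Q * (real N - 2) \<le> 2 * real N"
    using Q(2) N(1) by (simp add: pos_le_divide_eq)
  have sumv: "(\<Sum>b\<in>(Basis :: ('m, 'p) point set). y_weight \<gamma> b) = \<gamma> * (real k - 1)"
    using assms(1,4) by (simp add: sum_y_weight of_nat_diff)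
  define a where "a = B * Q / 2 + A"
  define \<alpha> where "\<alpha> = 1 - (Q - 2) * (real N - 1) / (Q + 2)"
  define C where "C = (\<bar>a\<bar> powr (- \<alpha>)) powr ((Q + 2) / Q) * (Q / 2 + 1)\<^sup>2"
  have a: "a \<noteq> 0" "0 < a \<longleftrightarrow> 0 < B * Q + 2 * A"
    using assms(6) by (auto simp: a_def)
  have C: "C > 0"
    using a Q by (auto simp: C_def)
  have main: "weighted_ineq C A B Q \<gamma> f"
    if f: "f \<in> test_functions (UNIV :: ('m, 'p) point set)"
      and bdry: "0 < a \<or> (\<exists>d>0. \<forall>x. height x < d \<longrightarrow> f x = 0)" for f
  proof -
    let ?f' = "\<lambda>x. frechet_derivative f (at x)"
    note f' = test_functionsD(1,2)[OF f]
    obtain R where R: "\<And>x. R \<le> norm x \<Longrightarrow> f x = 0"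
      using test_functionsD(3)[OF f] by blast
    define \<Phi> where "\<Phi> x = (\<Sum>b\<in>Basis. ((x \<bullet> ?e) powr y_weight \<gamma> b * ?f' x b)\<^sup>2)" for x
    have \<Phi>: "0 \<le> \<Phi> x" for x
      unfolding \<Phi>_def by (intro sum_nonneg) auto
    have "continuous_on UNIV f"
      using f'(1) by (meson has_derivative_continuous continuous_at_imp_continuous_on)
    then have [measurable]: "f \<in> borel_measurable borel"
      by (rule borel_measurable_continuous_onI)
    let ?X = "\<lambda>\<delta>. trunc_integral ?e \<delta> (B * Q) (\<lambda>x. \<bar>f x\<bar> powr Q)"
    let ?W = "\<lambda>\<delta>. trunc_integral ?e \<delta> (2 * A) \<Phi>"
    have trunc: "enn_powr (?X \<delta>) (2 / Q) \<le> ennreal C * ?W \<delta>"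
      if "0 < \<delta>" "0 < a \<or> (\<forall>x. x \<bullet> ?e = \<delta> \<longrightarrow> f x = 0)" for \<delta>
      unfolding C_def \<alpha>_def a_def \<Phi>_def N(2)[symmetric]
      using N Q QN a that f' R B sumv
      by (intro caffarelli_kohn_nirenberg_truncated[where R = R] vert_Basis)
         (auto simp: y_weight_def vert_def a_def)
    have "?X (1 / real (Suc n)) \<le> enn_powr (ennreal C * ?W 0) (Q / 2)" for n
    proof -
      \<comment> \<open>For \<open>a < 0\<close> the truncation height is lowered until \<open>f\<close> vanishes there.\<close>
      obtain \<delta> where \<delta>: "0 < \<delta>" "\<delta> \<le> 1 / real (Suc n)" "0 < a \<or> (\<forall>x. x \<bullet> ?e = \<delta> \<longrightarrow> f x = 0)"
      proof (cases "0 < a")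
        case True
        then show ?thesis
          by (intro that[of "1 / real (Suc n)"]) auto
      next
        case False
        then obtain d where "0 < d" "\<And>x. height x < d \<Longrightarrow> f x = 0"
          using bdry by blast
        then show ?thesis
          by (intro that[of "min (d / 2) (1 / real (Suc n))"]) (auto simp: height_eq_inner min_def)
      qed
      have "enn_powr (?X (1 / real (Suc n))) (2 / Q) \<le> enn_powr (?X \<delta>) (2 / Q)"
        using Q \<delta> by (intro enn_powr_mono trunc_integral_antimono) auto
      also have "\<dots> \<le> ennreal C * ?W \<delta>"
        by (intro trunc \<delta>)
      also have "\<dots> \<le> ennreal C * ?W 0"
        using \<delta> \<Phi> by (intro mult_left_mono trunc_integral_antimono) auto
      finally have "enn_powr (enn_powr (?X (1 / real (Suc n))) (2 / Q)) (Q / 2) \<le> enn_powr (ennreal C * ?W 0) (Q / 2)"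
        using Q by (intro enn_powr_mono) auto
      then show ?thesis
        using Q by (simp add: enn_powr_powr)
    qed
    then have "?X 0 \<le> enn_powr (ennreal C * ?W 0) (Q / 2)"
      by (intro trunc_integral_zero_le) auto
    then have "enn_powr (?X 0) (2 / Q) \<le> enn_powr (enn_powr (ennreal C * ?W 0) (Q / 2)) (2 / Q)"
      using Q by (intro enn_powr_mono) auto
    also have "\<dots> = ennreal C * ?W 0"
      using Q by (simp add: enn_powr_powr)
    finally have *: "enn_powr (?X 0) (2 / Q) \<le> ennreal C * ?W 0" .
    have X: "?X 0 = (\<integral>\<^sup>+x\<in>half_space. ennreal (height x powr (B * Q) * \<bar>f x\<bar> powr Q) \<partial>lborel)"
      unfolding trunc_integral_def
      by (intro nn_integral_cong) (auto simp: indicator_def half_space_def height_eq_inner)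
    have W: "?W 0 = (\<integral>\<^sup>+x\<in>half_space. ennreal (height x powr (2 * A) *
          ((norm (grad_x f x))\<^sup>2 + height x powr (2 * \<gamma>) * (norm (grad_y f x))\<^sup>2)) \<partial>lborel)"
      unfolding trunc_integral_def
    proof (intro nn_integral_cong)
      fix x :: "('m, 'p) point"
      show "ennreal (indicator {0<..} (x \<bullet> ?e) * ((x \<bullet> ?e) powr (2 * A) * \<Phi> x))
        = ennreal (height x powr (2 * A) *
          ((norm (grad_x f x))\<^sup>2 + height x powr (2 * \<gamma>) * (norm (grad_y f x))\<^sup>2)) * indicator half_space x"
        using energy_density_eq[OF f'(1), of x \<gamma>]
        by (cases "0 < height x") (auto simp: \<Phi>_def half_space_def height_eq_inner)
    qed
    show ?thesis
      using * unfolding weighted_ineq_def X W .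
  qed
  show ?thesis
  proof (intro exI[of _ C] conjI impI ballI C)
    fix f :: "('m, 'p) point \<Rightarrow> real" assume f: "f \<in> test_functions half_space"
    then obtain d where "0 < d" "\<And>x. height x < d \<Longrightarrow> f x = 0"
      by (rule test_functions_away_from_boundary) blast
    moreover have "f \<in> test_functions UNIV"
      using f by (auto simp: test_functions_def)
    ultimately show "weighted_ineq C A B Q \<gamma> f"
      by (intro main) auto
  next
    fix f :: "('m, 'p) point \<Rightarrow> real"
    assume "0 < B * Q + 2 * A" "f \<in> test_functions UNIV"
    then show "weighted_ineq C A B Q \<gamma> f"
      using a by (intro main) auto
  qed
qed

end
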